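(* Let $n \geq 2$ and let $\mu$ be a real number with $0 \leq 2\mu < n$. Then there exist a bounded measurable matrix-valued function $A:\mathbb{R}^n \to \mathbb{C}^{n\times n}$ satisfying the uniform ellipticity condition $$\mathrm{Re}\big(A_{kl}(x)p_k\overline{p}_l\big) \geq \lambda |p|^2, \qquad |A(x)p|^2 \leq \Lambda^2|p|^2 \qquad \text{for all } x\in\mathbb{R}^n,\ p\in\mathbb{C}^n$$ for some constants $\lambda,\Lambda>0$, and a nontrivial function $w\in H^1_{loc}(\mathbb{R}^n;\mathbb{C})$ solving (in the sense of distributions) the equation $$\mathrm{div}(A(x)\nabla w) = \tfrac{1}{2}\big(iw + \mu w + x\cdot\nabla w\big) \quad \text{on } \mathbb{R}^n,$$ such that $$w(x) = |x|^{-\mu}\, g(x/|x|)\, e^{-i\log|x|}\big(1 + \mathcal{E}(|x|^{-2})\big) \quad \text{for } x\in\mathbb{R}^n\setminus B_1,$$ where $g\in C^\infty(S^{n-1})$ and $\mathcal{E}$ is a smooth function with $\mathcal{E}(0)=0$.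
   Context: Summation over repeated indices $k,l$ is used. $B_1$ is the open unit ball of $\mathbb{R}^n$ centered at the origin and $S^{n-1}$ is the unit sphere. *)

theory Defs
  imports "HOL-Analysis.Analysis"
begin

fun Ck_on :: "nat \<Rightarrow> 'a::euclidean_space set \<Rightarrow> ('a \<Rightarrow> 'b::real_normed_vector) \<Rightarrow> bool" where
  "Ck_on 0 S f = continuous_on S f"
| "Ck_on (Suc k) S f =
     (f differentiable_on S \<and> (\<forall>b\<in>Basis. Ck_on k S (\<lambda>x. frechet_derivative f (at x) b)))"

definition smooth_on :: "'a::euclidean_space set \<Rightarrow> ('a \<Rightarrow> 'b::real_normed_vector) \<Rightarrow> bool" where
  "smooth_on S f \<longleftrightarrow> open S \<and> (\<forall>k. Ck_on k S f)"

definition smooth_on_sphere :: "(real^'n \<Rightarrow> complex) \<Rightarrow> bool" where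
  "smooth_on_sphere g \<longleftrightarrow>
     (\<exists>U G. sphere 0 1 \<subseteq> U \<and> smooth_on U G \<and> (\<forall>x\<in>sphere 0 1. G x = g x))"

definition pd :: "(real^'n \<Rightarrow> complex) \<Rightarrow> 'n \<Rightarrow> real^'n \<Rightarrow> complex" where
  "pd f k x = frechet_derivative f (at x) (axis k 1)"

definition test_fun :: "(real^'n \<Rightarrow> complex) \<Rightarrow> bool" where
  "test_fun \<phi> \<longleftrightarrow> smooth_on UNIV \<phi> \<and> bounded {x. \<phi> x \<noteq> 0}"

definition L2_loc :: "(real^'n \<Rightarrow> complex) \<Rightarrow> bool" where
  "L2_loc f \<longleftrightarrow> f \<in> borel_measurable lebesgue \<and>
     (\<forall>K. compact K \<longrightarrow> set_integrable lebesgue K (\<lambda>x. (cmod (f x))\<^sup>2))"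

definition weak_gradient :: "(real^'n \<Rightarrow> complex) \<Rightarrow> (real^'n \<Rightarrow> complex^'n) \<Rightarrow> bool" where
  "weak_gradient w G \<longleftrightarrow> (\<forall>\<phi> k. test_fun \<phi> \<longrightarrow>
      integrable lebesgue (\<lambda>x. w x * pd \<phi> k x) \<and>
      integrable lebesgue (\<lambda>x. G x $ k * \<phi> x) \<and>
      (LINT x|lebesgue. w x * pd \<phi> k x) = - (LINT x|lebesgue. G x $ k * \<phi> x))"

definition H1_loc :: "(real^'n \<Rightarrow> complex) \<Rightarrow> (real^'n \<Rightarrow> complex^'n) \<Rightarrow> bool" where
  "H1_loc w G \<longleftrightarrow> L2_loc w \<and> (\<forall>k. L2_loc (\<lambda>x. G x $ k)) \<and> weak_gradient w G"

definition bounded_measurable_matrix :: "(real^'n \<Rightarrow> complex^'n^'n) \<Rightarrow> bool" where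
  "bounded_measurable_matrix A \<longleftrightarrow>
     (\<forall>k l. (\<lambda>x. A x $ k $ l) \<in> borel_measurable lebesgue) \<and>
     (\<exists>M. \<forall>x k l. cmod (A x $ k $ l) \<le> M)"

definition uniformly_elliptic :: "(real^'n \<Rightarrow> complex^'n^'n) \<Rightarrow> real \<Rightarrow> real \<Rightarrow> bool" where
  "uniformly_elliptic A lam Lam \<longleftrightarrow> (\<forall>x (p::complex^'n).
     Re (\<Sum>k\<in>UNIV. \<Sum>l\<in>UNIV. A x $ k $ l * p $ k * cnj (p $ l)) \<ge> lam * (norm p)\<^sup>2 \<and>
     (norm (A x *v p))\<^sup>2 \<le> Lam\<^sup>2 * (norm p)\<^sup>2)"

text \<open>Distributional solution of div(A grad w) = (i w + mu w + x . grad w)/2, where G = grad w: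
  for all test functions phi,  - int (A grad w) . grad phi = int f phi.\<close>
definition weak_solution ::
  "(real^'n \<Rightarrow> complex^'n^'n) \<Rightarrow> real \<Rightarrow> (real^'n \<Rightarrow> complex) \<Rightarrow> (real^'n \<Rightarrow> complex^'n) \<Rightarrow> bool" where
  "weak_solution A \<mu> w G \<longleftrightarrow> (\<forall>\<phi>. test_fun \<phi> \<longrightarrow>
     (let a = (\<lambda>x. \<Sum>k\<in>UNIV. \<Sum>l\<in>UNIV. A x $ k $ l * G x $ l * pd \<phi> k x);
          f = (\<lambda>x. (1/2) * (\<i> * w x + of_real \<mu> * w x + (\<Sum>k\<in>UNIV. of_real (x $ k) * G x $ k)))
      in integrable lebesgue a \<and> integrable lebesgue (\<lambda>x. f x * \<phi> x) \<and>
         - (LINT x|lebesgue. a x) = (LINT x|lebesgue. f x * \<phi> x)))"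

end

theory Submission
  imports Defs
begin

text \<open>With \<open>s = |x|\<^sup>2\<close> we look for \<open>w = x\<^sub>1 H(s)\<close> and a matrix \<open>A\<close> that acts as multiplication by \<open>a(s)\<close>
  in the radial direction and by \<open>b(s)\<close> in the tangential ones. For given \<open>H\<close> and a given radial flux
  \<open>\<gamma> = q H = a (H + 2 s H')\<close>, the equation is solved algebraically for \<open>b\<close>, so that only the bounds and
  the positivity of \<open>Re a\<close> and \<open>Re b\<close> remain. They hold for
  \<open>H = (d + s\<^sup>2) powr (-(\<mu> + 1 + i)/4) \<cdot> (1 + c (1 + s\<^sup>2) powr (-1/2))\<close> and
  \<open>q = X ((d + s\<^sup>2) / (1 + s\<^sup>2)) powr (1/2 - \<delta>/8) \<cdot> (1 - i (\<mu> + \<delta>/4))\<close>, where \<open>\<delta> = min 1 (n - 2 \<mu>)\<close>,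
  \<open>c = \<delta>/32\<close>, \<open>X = \<delta>\<^sup>2/4096\<close> and \<open>d\<close> is tiny. The phase of \<open>q\<close> follows the rotation of \<open>w\<close>, the condition
  \<open>2 \<mu> < n\<close> leaves room for \<open>q/s\<close> to decay from the scale \<open>s = \<surd>d\<close> to the scale \<open>s = 1\<close>, and for larger \<open>s\<close>,
  where \<open>q\<close> stops growing, the drift acting on the correction \<open>c/s\<close> makes \<open>Re b\<close> positive.\<close>

section \<open>Integration by parts against test functions\<close>

text \<open>Translation invariance of Lebesgue measure gives the difference quotients of
  \<open>F\<close> along \<open>e\<close> integral 0. They are dominated by a multiple of the
  indicator of a ball, so dominated convergence passes this on to the derivative.\<close>

lemma integral_directional_derivative_eq_0:
  fixes F :: "'a::euclidean_space \<Rightarrow> complex"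
  assumes der: "\<And>x. (F has_derivative F' x) (at x)"
    and cont: "continuous_on UNIV (\<lambda>x. F' x e)"
    and bdd: "bounded {x. F x \<noteq> 0}"
  shows "integrable lebesgue (\<lambda>x. F' x e)" and "(LINT x|lebesgue. F' x e) = 0"
proof -
  obtain R where R: "R > 0" "\<And>x. F x \<noteq> 0 \<Longrightarrow> norm x \<le> R"
    using bdd by (auto simp: bounded_pos)
  \<comment> \<open>The increments \<open>h n\<close> are at most 1, so the quotients vanish outside
    \<open>S\<close>. A segment that starts in \<open>S\<close> stays within radius
    \<open>R + 2 * norm e\<close>, which is the ball on which \<open>M\<close> bounds the
    derivative.\<close>
  define S where "S = cball (0::'a) (R + norm e)"
  have "compact ((\<lambda>x. F' x e) ` cball 0 (R + 2 * norm e))"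
    by (rule compact_continuous_image) (auto intro: continuous_on_subset[OF cont])
  then obtain M where M: "M > 0" "\<And>x. norm x \<le> R + 2 * norm e \<Longrightarrow> norm (F' x e) \<le> M"
    using compact_imp_bounded[of "(\<lambda>x. F' x e) ` cball 0 (R + 2 * norm e)"]
    by (auto simp: bounded_pos)
  have Fcont: "continuous_on UNIV F"
    using der by (meson continuous_at_imp_continuous_on has_derivative_continuous)
  have [measurable]: "F \<in> borel_measurable borel"
    using Fcont by (rule borel_measurable_continuous_onI)
  have m': "(\<lambda>x. F' x e) \<in> borel_measurable borel"
    using cont by (rule borel_measurable_continuous_onI)
  define h where "h = (\<lambda>n::nat. inverse (real (Suc n)))"
  have h: "0 < h n" "h n \<le> 1" for n
    by (auto simp: h_def field_simps)
  have h0: "h \<longlonglongrightarrow> 0"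
    unfolding h_def by (rule LIMSEQ_inverse_real_of_nat)
  define D where "D = (\<lambda>n x. (F (x + h n *\<^sub>R e) - F x) /\<^sub>R h n)"
  have dir: "((\<lambda>t. F (x + t *\<^sub>R e)) has_vector_derivative F' (x + t *\<^sub>R e) e) (at t)" for x t
  proof -
    have "((\<lambda>t. F (x + t *\<^sub>R e)) has_derivative (\<lambda>y. F' (x + t *\<^sub>R e) (y *\<^sub>R e))) (at t)"
      by (rule has_derivative_compose[OF _ der]) (auto intro!: derivative_eq_intros)
    moreover have "F' (x + t *\<^sub>R e) (y *\<^sub>R e) = y *\<^sub>R F' (x + t *\<^sub>R e) e" for y
      using der by (simp add: has_derivative_def bounded_linear.linear linear_simps(5))
    ultimately show ?thesis
      by (simp add: has_vector_derivative_def)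
  qed
  have lim: "(\<lambda>n. D n x) \<longlonglongrightarrow> F' x e" for x
  proof -
    have "((\<lambda>t. (F (x + t *\<^sub>R e) - F x) /\<^sub>R t) \<longlongrightarrow> F' x e) (at 0)"
    proof -
      have "((\<lambda>t. norm (F (x + t *\<^sub>R e) - F x - t *\<^sub>R F' x e) / norm t) \<longlongrightarrow> 0) (at 0)"
        using dir[of x 0] by (simp add: has_vector_derivative_def has_derivative_iff_norm)
      then have "((\<lambda>t. norm ((F (x + t *\<^sub>R e) - F x) /\<^sub>R t - F' x e)) \<longlongrightarrow> 0) (at 0)"
      proof (rule Lim_transform_eventually)
        have "norm (F (x + t *\<^sub>R e) - F x - t *\<^sub>R F' x e) / norm t
            = norm ((F (x + t *\<^sub>R e) - F x) /\<^sub>R t - F' x e)" if "t \<noteq> 0" for t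
        proof -
          have "(F (x + t *\<^sub>R e) - F x) /\<^sub>R t - F' x e
              = (F (x + t *\<^sub>R e) - F x - t *\<^sub>R F' x e) /\<^sub>R t"
            using that by (simp add: scaleR_diff_right)
          then show ?thesis by (simp add: divide_inverse mult.commute)
        qed
        then show "\<forall>\<^sub>F t in at 0. norm (F (x + t *\<^sub>R e) - F x - t *\<^sub>R F' x e) / norm t
            = norm ((F (x + t *\<^sub>R e) - F x) /\<^sub>R t - F' x e)"
          by (auto simp: eventually_at_filter)
      qed
      then show ?thesis
        by (simp add: tendsto_norm_zero_iff LIM_zero_iff)
    qed
    moreover have "filterlim h (at 0) sequentially"
      using h0 h(1) by (simp add: filterlim_at less_imp_neq[THEN not_sym])
    ultimately show ?thesis
      unfolding D_def by (rule filterlim_compose)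
  qed
  have bound: "norm (D n x) \<le> M * indicator S x" for n x
  proof (cases "x \<in> S")
    case False
    then have "norm x > R + norm e" by (simp add: S_def)
    moreover have "norm (h n *\<^sub>R e) \<le> norm e"
      using h[of n] by (simp add: mult_left_le_one_le)
    ultimately have "norm (x + h n *\<^sub>R e) > R" "norm x > R"
      using norm_triangle_ineq4[of "x + h n *\<^sub>R e" "h n *\<^sub>R e"] norm_ge_zero[of e]
      unfolding add_diff_cancel_right' by linarith+
    then have "F (x + h n *\<^sub>R e) = 0" "F x = 0"
      using R(2) by (metis not_less)+
    then show ?thesis using False by (simp add: D_def)
  next
    case True
    have "norm (F (x + h n *\<^sub>R e) - F (x + 0 *\<^sub>R e)) \<le> M * norm (h n - 0)"
    proof (rule differentiable_bound[where S = "{0..h n}" and f = "\<lambda>t. F (x + t *\<^sub>R e)"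
          and f' = "\<lambda>t y. y *\<^sub>R F' (x + t *\<^sub>R e) e"])
      fix t assume t: "t \<in> {0..h n}"
      show "((\<lambda>t. F (x + t *\<^sub>R e)) has_derivative (\<lambda>y. y *\<^sub>R F' (x + t *\<^sub>R e) e)) (at t within {0..h n})"
        using dir[of x t] by (auto simp: has_vector_derivative_def intro: has_derivative_at_withinI)
      have "norm (t *\<^sub>R e) \<le> norm e"
        using t h[of n] by (simp add: mult_left_le_one_le)
      then have "norm (x + t *\<^sub>R e) \<le> R + 2 * norm e"
        using True norm_triangle_ineq[of x "t *\<^sub>R e"] by (simp add: S_def)
      then have "norm (F' (x + t *\<^sub>R e) e) \<le> M" by (rule M)
      then show "onorm (\<lambda>y. y *\<^sub>R F' (x + t *\<^sub>R e) e) \<le> M"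
        by (intro onorm_le) (simp add: mult.commute[of M] mult_left_mono)
    qed (use h[of n] in auto)
    then show ?thesis
      using True h[of n] by (simp add: D_def norm_scaleR divide_inverse[symmetric] pos_divide_le_eq
          mult.commute[of "inverse _"])
  qed
  have int_F: "integrable lborel F"
  proof -
    have "integrable lborel (\<lambda>x. indicator (cball 0 R) x *\<^sub>R F x)"
      by (rule borel_integrable_compact) (auto intro: continuous_on_subset[OF Fcont])
    moreover have "(\<lambda>x. indicator (cball 0 R) x *\<^sub>R F x) = F"
      using R(2) by (force simp: indicator_def)
    ultimately show ?thesis by simp
  qed
  have D0: "(LINT x|lborel. D n x) = 0" for n
  proof -
    have *: "integrable (distr lborel borel ((+) (h n *\<^sub>R e))) F"
      using int_F by (simp add: lborel_distr_plus)
    have i2: "integrable lborel (\<lambda>x. F (h n *\<^sub>R e + x))"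
      using * by (subst (asm) integrable_distr_eq) auto
    have "(LINT x|lborel. F (h n *\<^sub>R e + x)) = (LINT x|distr lborel borel ((+) (h n *\<^sub>R e)). F x)"
      by (subst integral_distr) auto
    also have "\<dots> = (LINT x|lborel. F x)"
      by (simp add: lborel_distr_plus)
    finally show ?thesis
      using i2 int_F by (simp add: D_def add.commute)
  qed
  have intb: "integrable lborel (\<lambda>x. M * indicator S x)"
    unfolding S_def
    by (intro integrable_mult_right integrable_real_indicator emeasure_lborel_cball_finite) auto
  have mD: "D n \<in> borel_measurable lborel" for n
    unfolding D_def by measurable
  have i: "integrable lborel (\<lambda>x. F' x e)"
    by (rule integrable_dominated_convergence[where s = D, OF _ mD intb]) (use m' lim bound in auto)
  have "(\<lambda>n. LINT x|lborel. D n x) \<longlonglongrightarrow> (LINT x|lborel. F' x e)"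
    by (rule integral_dominated_convergence[where s = D, OF _ mD intb]) (use m' lim bound in auto)
  then have "(LINT x|lborel. F' x e) = 0"
    using D0 by (simp add: LIMSEQ_const_iff)
  then show "integrable lebesgue (\<lambda>x. F' x e)" "(LINT x|lebesgue. F' x e) = 0"
    using i m' by (simp_all add: integral_completion integrable_completion)
qed

lemma test_fun_differentiable: "test_fun \<phi> \<Longrightarrow> (\<phi> has_derivative frechet_derivative \<phi> (at x)) (at x)"
  by (auto simp: test_fun_def smooth_on_def differentiable_on_def frechet_derivative_works
      dest!: spec[where x = "Suc 0"])

lemma test_fun_pd_continuous: "test_fun \<phi> \<Longrightarrow> continuous_on UNIV (pd \<phi> k)"
  by (auto simp: test_fun_def smooth_on_def pd_def axis_in_Basis_iff dest!: spec[where x = "Suc 0"])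
    
lemma test_fun_continuous: "test_fun \<phi> \<Longrightarrow> continuous_on UNIV \<phi>"
  by (auto simp: test_fun_def smooth_on_def dest!: spec[where x = "0"])

lemma integrable_continuous_bounded_support:
  fixes f :: "'a::euclidean_space \<Rightarrow> complex"
  assumes "continuous_on UNIV f" and "bounded {x. f x \<noteq> 0}"
  shows "integrable lebesgue f"
proof -
  obtain R where R: "\<And>x. f x \<noteq> 0 \<Longrightarrow> norm x \<le> R"
    using assms(2) by (auto simp: bounded_pos)
  have "integrable lborel (\<lambda>x. indicator (cball 0 R) x *\<^sub>R f x)"
    by (rule borel_integrable_compact) (auto intro: continuous_on_subset[OF assms(1)])
  moreover have "(\<lambda>x. indicator (cball 0 R) x *\<^sub>R f x) = f"
    using R by (force simp: indicator_def)
  ultimately show ?thesis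
    using assms(1) by (simp add: integrable_completion borel_measurable_continuous_onI)
qed

text \<open>The product of \<open>F\<close> and \<open>\<phi>\<close> has bounded support, so its
  partial derivative integrates to 0, and the product rule splits that integral. No decay of
  \<open>F\<close> is involved, since \<open>\<phi>\<close> localises everything.\<close>

lemma integration_by_parts_test_fun:
  fixes F :: "real^'n \<Rightarrow> complex"
  assumes der: "\<And>x. (F has_derivative F' x) (at x)"
    and cont: "continuous_on UNIV (\<lambda>x. F' x (axis k 1))"
    and \<phi>: "test_fun \<phi>"
  shows "integrable lebesgue (\<lambda>x. F x * pd \<phi> k x)"
    and "integrable lebesgue (\<lambda>x. F' x (axis k 1) * \<phi> x)"
    and "(LINT x|lebesgue. F x * pd \<phi> k x) = - (LINT x|lebesgue. F' x (axis k 1) * \<phi> x)"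
proof -
  define P' where "P' = (\<lambda>x v. F x * frechet_derivative \<phi> (at x) v + F' x v * \<phi> x)"
  have P'_eq: "P' x (axis k 1) = F x * pd \<phi> k x + F' x (axis k 1) * \<phi> x" for x
    by (simp add: P'_def pd_def)
  have Fc: "continuous_on UNIV F"
    using der by (meson continuous_at_imp_continuous_on has_derivative_continuous)
  have P: "((\<lambda>x. F x * \<phi> x) has_derivative P' x) (at x)" for x
    unfolding P'_def by (rule has_derivative_mult[OF der test_fun_differentiable[OF \<phi>]])
  have c: "continuous_on UNIV (\<lambda>x. P' x (axis k 1))"
    unfolding P'_eq
    by (intro continuous_intros Fc cont test_fun_pd_continuous[OF \<phi>] test_fun_continuous[OF \<phi>])
  have b: "bounded {x. \<phi> x \<noteq> 0}"
    using \<phi> by (simp add: test_fun_def)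
  then have b1: "bounded {x. F x * \<phi> x \<noteq> 0}"
    by (rule bounded_subset) auto
  show i2: "integrable lebesgue (\<lambda>x. F' x (axis k 1) * \<phi> x)"
    by (intro integrable_continuous_bounded_support continuous_intros cont
        test_fun_continuous[OF \<phi>] bounded_subset[OF b]) auto
  have i: "integrable lebesgue (\<lambda>x. P' x (axis k 1))" "(LINT x|lebesgue. P' x (axis k 1)) = 0"
    using integral_directional_derivative_eq_0[OF P c b1] by auto
  have eq: "F x * pd \<phi> k x = P' x (axis k 1) - F' x (axis k 1) * \<phi> x" for x
    by (simp add: P'_eq)
  show "integrable lebesgue (\<lambda>x. F x * pd \<phi> k x)"
    unfolding eq using i i2 by auto
  show "(LINT x|lebesgue. F x * pd \<phi> k x) = - (LINT x|lebesgue. F' x (axis k 1) * \<phi> x)"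
    unfolding eq using i i2 by simp
qed

section \<open>Solutions with a radial profile\<close>

text \<open>Profiles depend on the squared norm, which is smooth at the origin too. No neighbourhood
  of 0 has to be cut out in the integrations by parts.\<close>

lemma has_derivative_fun_norm_square:
  fixes x :: "'a::real_inner" and h :: "real \<Rightarrow> complex"
  assumes "\<And>s. (h has_vector_derivative h' s) (at s)"
  shows "((\<lambda>x. h ((norm x)\<^sup>2)) has_derivative (\<lambda>v. of_real (2 * (x \<bullet> v)) * h' ((norm x)\<^sup>2))) (at x)"
proof -
  have "((\<lambda>x. h (x \<bullet> x)) has_derivative (\<lambda>v. (2 * (x \<bullet> v)) *\<^sub>R h' (x \<bullet> x))) (at x)"
    by (rule has_derivative_compose[where f = "\<lambda>x. x \<bullet> x" and g = h and g' = "\<lambda>y. y *\<^sub>R h' (x \<bullet> x)"])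
      (use assms[of "x \<bullet> x"] in \<open>auto intro!: derivative_eq_intros
        simp: has_vector_derivative_def inner_commute\<close>)
  then show ?thesis
    by (simp add: power2_norm_eq_inner scaleR_conv_of_real)
qed

lemma has_derivative_of_real_nth:
  "((\<lambda>x::real^'n. complex_of_real (x $ k)) has_derivative (\<lambda>v. of_real (v $ k))) (at x)"
  by (rule bounded_linear_imp_has_derivative)
    (intro bounded_linear_compose[OF bounded_linear_of_real] bounded_linear_vec_nth)

lemma axis_nth_if: "axis k c $ i = (if i = k then c else 0)"
  by (simp add: axis_def)

lemma L2_loc_continuous:
  fixes f :: "real^'n \<Rightarrow> complex"
  assumes "continuous_on UNIV f"
  shows "L2_loc f"
proof -
  have [measurable]: "f \<in> borel_measurable borel"
    using assms by (rule borel_measurable_continuous_onI)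
  have "set_integrable lebesgue K (\<lambda>x. (cmod (f x))\<^sup>2)" if "compact K" for K
  proof -
    have "integrable lborel (\<lambda>x. indicator K x *\<^sub>R (cmod (f x))\<^sup>2)"
      by (intro borel_integrable_compact that continuous_intros continuous_on_subset[OF assms]) auto
    then show ?thesis
      using that unfolding set_integrable_def
      by (subst integrable_completion) (auto dest: compact_imp_closed)
  qed
  then show ?thesis
    by (auto simp: L2_loc_def measurable_completion)
qed

lemma norm_sum_of_real_mult_le:
  fixes p :: "complex^'n" and x :: "real^'n"
  shows "cmod (\<Sum>l\<in>UNIV. of_real (x $ l) * p $ l) \<le> norm x * norm p"
proof -
  have "cmod (\<Sum>l\<in>UNIV. of_real (x $ l) * p $ l) \<le> (\<Sum>l\<in>UNIV. \<bar>x $ l\<bar> * \<bar>cmod (p $ l)\<bar>)"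
    by (rule order_trans[OF norm_sum]) (simp add: norm_mult)
  also have "\<dots> \<le> L2_set (\<lambda>l. x $ l) UNIV * L2_set (\<lambda>l. cmod (p $ l)) UNIV"
    by (rule L2_set_mult_ineq)
  also have "\<dots> = norm x * norm p"
    by (simp add: norm_vec_def L2_set_def)
  finally show ?thesis .
qed

text \<open>The solution is \<open>w = x\<^sub>k\<^sub>0 H(s)\<close> for a fixed index \<open>k0\<close>, its flux \<open>A \<nabla>w\<close> is \<open>\<alpha>(s) e\<^sub>k\<^sub>0 + \<beta>(s) x\<^sub>k\<^sub>0 x\<close>; the numbers \<open>a(s)\<close> and \<open>b(s)\<close> are the eigenvalues of \<open>A\<close> in
  the radial and tangential directions, and \<open>balance\<close> is the equation after division by \<open>x\<^sub>k\<^sub>0\<close>.\<close>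

locale radial_profile =
  fixes k0 :: "'n::finite" and \<mu> :: real
    and H H' \<alpha> \<alpha>' \<beta> \<beta>' a b :: "real \<Rightarrow> complex" and lam M :: real
  assumes H: "\<And>s. (H has_vector_derivative H' s) (at s)" "continuous_on UNIV H'"
    and \<alpha>: "\<And>s. (\<alpha> has_vector_derivative \<alpha>' s) (at s)" "continuous_on UNIV \<alpha>'"
    and \<beta>: "\<And>s. (\<beta> has_vector_derivative \<beta>' s) (at s)" "continuous_on UNIV \<beta>'"
    and balance: "\<And>s. s \<ge> 0 \<Longrightarrow> 2 * \<alpha>' s + of_real (2 * s) * \<beta>' s + of_nat (CARD('n) + 1) * \<beta> s
      = (1/2) * ((\<i> + of_real \<mu> + 1) * H s + of_real (2 * s) * H' s)"
    and measurable_ab: "a \<in> borel_measurable borel" "b \<in> borel_measurable borel"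
    and radial: "\<And>s. s \<ge> 0 \<Longrightarrow> a s * (H s + of_real (2 * s) * H' s) = \<alpha> s + of_real s * \<beta> s"
    and tangential: "\<And>s. s \<ge> 0 \<Longrightarrow> b s * H s = \<alpha> s"
    and lower: "lam > 0" "\<And>s. s \<ge> 0 \<Longrightarrow> lam \<le> Re (a s)" "\<And>s. s \<ge> 0 \<Longrightarrow> lam \<le> Re (b s)"
    and upper: "\<And>s. s \<ge> 0 \<Longrightarrow> cmod (a s) \<le> M" "\<And>s. s \<ge> 0 \<Longrightarrow> cmod (b s) \<le> M"
begin

definition sol :: "real^'n \<Rightarrow> complex" where
  "sol x = of_real (x $ k0) * H ((norm x)\<^sup>2)"

definition grad_sol :: "real^'n \<Rightarrow> complex^'n" where
  "grad_sol x = (\<chi> k. (if k = k0 then H ((norm x)\<^sup>2) else 0)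
     + of_real (2 * x $ k0 * x $ k) * H' ((norm x)\<^sup>2))"

text \<open>At the origin the quotient is \<open>0/0 = 0\<close>, so the value there is \<open>b(0)\<close> times the identity.\<close>

definition coeff :: "real^'n \<Rightarrow> complex^'n^'n" where
  "coeff x = (\<chi> k l. (if k = l then b ((norm x)\<^sup>2) else 0)
     + (a ((norm x)\<^sup>2) - b ((norm x)\<^sup>2)) * of_real (x $ k * x $ l / (norm x)\<^sup>2))"

definition flux :: "real^'n \<Rightarrow> 'n \<Rightarrow> complex" where
  "flux x k = (if k = k0 then \<alpha> ((norm x)\<^sup>2) else 0)
     + of_real (x $ k0 * x $ k) * \<beta> ((norm x)\<^sup>2)"

lemma M_pos: "M > 0"
  using lower(1) lower(2)[of 0] upper(1)[of 0] complex_Re_le_cmod[of "a 0"] by linarith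

lemma continuous_profiles:
  "continuous_on S H" "continuous_on S \<alpha>" "continuous_on S \<beta>"
  "continuous_on S H'" "continuous_on S \<alpha>'" "continuous_on S \<beta>'"
  using H \<alpha> \<beta> continuous_on_subset[OF _ subset_UNIV]
  by (meson has_vector_derivative_continuous continuous_at_imp_continuous_on)+

lemma continuous_fun_norm_square:
  assumes "\<And>S. continuous_on S h"
  shows "continuous_on S (\<lambda>x::real^'n. h ((norm x)\<^sup>2))"
  by (rule continuous_on_compose2[OF assms[of UNIV]]) (auto intro!: continuous_intros)

lemmas continuous_profiles_norm = continuous_profiles[THEN continuous_fun_norm_square]

text \<open>With s = |x|^2, the matrix is b I + (a - b) x x^T / s, and the product of x with the
  gradient is \<open>x $ k0\<close> times H + 2 s H'. Inserting \<open>radial\<close> and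
  \<open>tangential\<close> leaves \<beta> - 2 b H' as the coefficient of the rank-one part; the
  term 2 b H' cancels against the one from b times the gradient.\<close>

lemma coeff_grad_sol: "(\<Sum>l\<in>UNIV. coeff x $ k $ l * grad_sol x $ l) = flux x k"
proof -
  define s where "s = (norm x)\<^sup>2"
  have s: "s \<ge> 0" by (simp add: s_def)
  have sum_sq: "(\<Sum>l\<in>UNIV. complex_of_real (x $ l) * of_real (x $ l)) = of_real s"
    by (simp add: s_def power2_norm_eq_inner inner_vec_def)
  let ?c = "(a s - b s) * of_real (x $ k / s)"
  have "(\<Sum>l\<in>UNIV. coeff x $ k $ l * grad_sol x $ l)
      = (\<Sum>l\<in>UNIV. (if k = l then b s * grad_sol x $ l else 0))
      + (\<Sum>l\<in>UNIV. ?c * of_real (x $ l) * grad_sol x $ l)"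
    unfolding sum.distrib[symmetric]
    by (intro sum.cong) (auto simp: coeff_def s_def[symmetric] algebra_simps diff_divide_distrib)
  also have "(\<Sum>l\<in>UNIV. ?c * of_real (x $ l) * grad_sol x $ l)
      = (\<Sum>l\<in>UNIV. if l = k0 then ?c * of_real (x $ l) * H s else 0)
      + (\<Sum>l\<in>UNIV. (?c * of_real (2 * x $ k0) * H' s) * (of_real (x $ l) * of_real (x $ l)))"
    unfolding sum.distrib[symmetric]
    by (intro sum.cong) (auto simp: grad_sol_def s_def[symmetric] algebra_simps)
  also have "\<dots> = ?c * of_real (x $ k0) * (H s + of_real (2 * s) * H' s)"
    unfolding sum_distrib_left[symmetric] sum_sq by (simp add: ring_distribs)
  finally have eq: "(\<Sum>l\<in>UNIV. coeff x $ k $ l * grad_sol x $ l)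
      = b s * grad_sol x $ k + ?c * of_real (x $ k0) * (H s + of_real (2 * s) * H' s)"
    by simp
  show ?thesis
  proof (cases "x = 0")
    case True
    then show ?thesis
      unfolding eq using tangential[of 0] by (simp add: grad_sol_def flux_def s_def)
  next
    case False
    then have s0: "s \<noteq> 0" by (simp add: s_def)
    have "?c * of_real (x $ k0) * (H s + of_real (2 * s) * H' s)
      = of_real (x $ k * x $ k0 / s) * (a s * (H s + of_real (2 * s) * H' s)
         - b s * H s - of_real (2 * s) * (b s * H' s))"
      using s0 by (simp add: field_simps)
    also have "\<dots> = of_real (x $ k * x $ k0) * (\<beta> s - 2 * (b s * H' s))"
      unfolding radial[OF s] tangential[OF s] using s0 by (simp add: field_simps)
    finally show ?thesis
      unfolding eq using tangential[OF s]
      by (auto simp: grad_sol_def flux_def s_def[symmetric] algebra_simps)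
  qed
qed

section \<open>Weak gradient and weak form of the equation\<close>

lemma H1_loc_sol: "H1_loc sol grad_sol"
proof -
  define D where "D = (\<lambda>x v. complex_of_real (x $ k0) * (of_real (2 * (x \<bullet> v)) * H' ((norm x)\<^sup>2))
      + of_real (v $ k0) * H ((norm x)\<^sup>2))"
  have D: "(sol has_derivative D x) (at x)" for x
    unfolding sol_def D_def
    by (rule has_derivative_mult[OF has_derivative_of_real_nth has_derivative_fun_norm_square[OF H(1)]])
  have grad: "grad_sol x $ k = D x (axis k 1)" for x k
    by (auto simp: D_def grad_sol_def inner_axis axis_nth_if algebra_simps)
  have cont: "continuous_on UNIV (\<lambda>x. D x (axis k 1))" for k
    unfolding D_def by (intro continuous_intros continuous_profiles_norm)
  have "continuous_on UNIV sol"
    unfolding sol_def by (intro continuous_intros continuous_profiles_norm)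
  moreover have "weak_gradient sol grad_sol"
    unfolding weak_gradient_def grad
    using integration_by_parts_test_fun[of sol D, OF D cont] by blast
  ultimately show ?thesis
    unfolding H1_loc_def grad using cont by (simp add: L2_loc_continuous)
qed

text \<open>By \<open>coeff_grad_sol\<close> the matrix enters only through the flux, which is
  continuously differentiable. Hence the equation can be checked pointwise and then integrated by
  parts, without differentiating the matrix.\<close>

lemma weak_solution_sol: "weak_solution coeff \<mu> sol grad_sol"
proof -
  define D where "D = (\<lambda>k x v. (if k = k0 then of_real (2 * (x \<bullet> v)) * \<alpha>' ((norm x)\<^sup>2) else 0)
      + (of_real (x $ k0) * of_real (x $ k) * (of_real (2 * (x \<bullet> v)) * \<beta>' ((norm x)\<^sup>2))
      + (of_real (x $ k0) * of_real (v $ k) + of_real (v $ k0) * of_real (x $ k)) * \<beta> ((norm x)\<^sup>2)))"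
  have D: "((\<lambda>x. flux x k) has_derivative D k x) (at x)" for k x
  proof -
    have "((\<lambda>x::real^'n. if k = k0 then \<alpha> ((norm x)\<^sup>2) else 0) has_derivative
        (\<lambda>v. if k = k0 then of_real (2 * (x \<bullet> v)) * \<alpha>' ((norm x)\<^sup>2) else 0)) (at x)"
      using has_derivative_fun_norm_square[OF \<alpha>(1), of x] by (cases "k = k0") auto
    then show ?thesis
      unfolding flux_def D_def of_real_mult[of "x $ k0" "x $ k" for x :: "real^'n"]
      by (intro has_derivative_add has_derivative_mult has_derivative_of_real_nth
          has_derivative_fun_norm_square[OF \<beta>(1)])
  qed
  have cont: "continuous_on UNIV (\<lambda>x. D k x (axis k 1))" for k
    unfolding D_def by (cases "k = k0") (auto intro!: continuous_intros continuous_profiles_norm)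
  \<comment> \<open>The divergence of \<alpha> in direction \<open>k0\<close> is 2 \<alpha>' times
    \<open>x $ k0\<close>. The vector field x multiplied by \<open>x $ k0\<close> has divergence n +
    1 times \<open>x $ k0\<close>, which is the source of the factor \<open>CARD('n) + 1\<close> in
    \<open>balance\<close>.\<close>
  have div: "(\<Sum>k\<in>UNIV. D k x (axis k 1))
      = (1/2) * (\<i> * sol x + of_real \<mu> * sol x + (\<Sum>k\<in>UNIV. of_real (x $ k) * grad_sol x $ k))" for x
  proof -
    define s where "s = (norm x)\<^sup>2"
    have s: "s \<ge> 0" by (simp add: s_def)
    have sum_sq: "(\<Sum>l\<in>UNIV. complex_of_real (x $ l) * of_real (x $ l)) = of_real s"
      by (simp add: s_def power2_norm_eq_inner inner_vec_def)
    have "(\<Sum>k\<in>UNIV. D k x (axis k 1))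
       = (\<Sum>k\<in>UNIV. if k = k0 then of_real (2 * x $ k) * \<alpha>' s + of_real (x $ k) * \<beta> s else 0)
       + (\<Sum>k\<in>UNIV. (of_real (2 * x $ k0) * \<beta>' s) * (of_real (x $ k) * of_real (x $ k)))
       + (\<Sum>k\<in>(UNIV::'n set). of_real (x $ k0) * \<beta> s)"
      unfolding sum.distrib[symmetric]
      by (intro sum.cong)
        (auto simp: D_def s_def[symmetric] inner_axis axis_nth_if algebra_simps)
    also have "\<dots> = of_real (x $ k0) *
        (2 * \<alpha>' s + of_real (2 * s) * \<beta>' s + of_nat (CARD('n) + 1) * \<beta> s)"
      unfolding sum_distrib_left[symmetric] sum_sq by (simp add: algebra_simps)
    also have "\<dots> = of_real (x $ k0) * ((1/2) * ((\<i> + of_real \<mu> + 1) * H s + of_real (2 * s) * H' s))"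
      by (simp only: balance[OF s])
    finally have lhs: "(\<Sum>k\<in>UNIV. D k x (axis k 1))
      = of_real (x $ k0) * ((1/2) * ((\<i> + of_real \<mu> + 1) * H s + of_real (2 * s) * H' s))" .
    have "(\<Sum>k\<in>UNIV. of_real (x $ k) * grad_sol x $ k)
       = (\<Sum>k\<in>UNIV. if k = k0 then of_real (x $ k) * H s else 0)
       + (\<Sum>k\<in>UNIV. (of_real (2 * x $ k0) * H' s) * (of_real (x $ k) * of_real (x $ k)))"
      unfolding sum.distrib[symmetric]
      by (intro sum.cong) (auto simp: grad_sol_def s_def[symmetric] algebra_simps)
    also have "\<dots> = of_real (x $ k0) * (H s + of_real (2 * s) * H' s)"
      unfolding sum_distrib_left[symmetric] sum_sq by (simp add: algebra_simps)
    finally show ?thesis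
      unfolding lhs by (simp add: sol_def s_def[symmetric] algebra_simps)
  qed
  show ?thesis
    unfolding weak_solution_def Let_def
  proof (intro allI impI)
    fix \<phi> :: "real^'n \<Rightarrow> complex" assume \<phi>: "test_fun \<phi>"
    note ibp = integration_by_parts_test_fun[of "\<lambda>x. flux x k" "D k" k for k, OF D cont \<phi>]
    have a: "(\<Sum>k\<in>UNIV. \<Sum>l\<in>UNIV. coeff x $ k $ l * grad_sol x $ l * pd \<phi> k x)
        = (\<Sum>k\<in>UNIV. flux x k * pd \<phi> k x)" for x
      by (simp add: sum_distrib_right[symmetric] coeff_grad_sol)
    show "integrable lebesgue (\<lambda>x. \<Sum>k\<in>UNIV. \<Sum>l\<in>UNIV. coeff x $ k $ l * grad_sol x $ l * pd \<phi> k x) \<and>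
      integrable lebesgue (\<lambda>x. (1/2) * (\<i> * sol x + of_real \<mu> * sol x
        + (\<Sum>k\<in>UNIV. of_real (x $ k) * grad_sol x $ k)) * \<phi> x) \<and>
      - (LINT x|lebesgue. (\<Sum>k\<in>UNIV. \<Sum>l\<in>UNIV. coeff x $ k $ l * grad_sol x $ l * pd \<phi> k x))
      = (LINT x|lebesgue. (1/2) * (\<i> * sol x + of_real \<mu> * sol x
        + (\<Sum>k\<in>UNIV. of_real (x $ k) * grad_sol x $ k)) * \<phi> x)"
      unfolding a div[symmetric] sum_distrib_right using ibp
      by (simp add: sum_negf)
  qed
qed

section \<open>Boundedness, ellipticity and nontriviality\<close>

lemma bounded_measurable_coeff: "bounded_measurable_matrix coeff"
  unfolding bounded_measurable_matrix_def
proof (intro conjI allI exI)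
  fix k l
  note [measurable] = measurable_ab
  have "(\<lambda>x. coeff x $ k $ l) \<in> borel_measurable borel"
    unfolding coeff_def vec_lambda_beta by measurable
  then show "(\<lambda>x. coeff x $ k $ l) \<in> borel_measurable lebesgue"
    by (simp add: measurable_completion)
next
  fix x :: "real^'n" and k l
  let ?s = "(norm x)\<^sup>2"
  have "\<bar>x $ k\<bar> * \<bar>x $ l\<bar> \<le> norm x * norm x"
    by (intro mult_mono component_le_norm_cart) auto
  then have 1: "\<bar>x $ k * x $ l / ?s\<bar> \<le> 1"
    by (simp add: abs_mult power2_eq_square divide_le_eq)
  have "cmod (a ?s - b ?s) * \<bar>x $ k * x $ l / ?s\<bar> \<le> (M + M) * 1"
    using norm_triangle_ineq4[of "a ?s" "b ?s"] upper[of ?s] M_pos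
    by (intro mult_mono 1) auto
  then have 2: "cmod ((a ?s - b ?s) * of_real (x $ k * x $ l / ?s)) \<le> 2 * M"
    by (simp only: norm_mult norm_of_real mult_2 mult_1_right)
  have 3: "cmod (if k = l then b ?s else 0) \<le> M"
    using upper(2)[of ?s] M_pos by auto
  show "cmod (coeff x $ k $ l) \<le> 3 * M"
    unfolding coeff_def vec_lambda_beta using norm_triangle_le[OF add_mono[OF 3 2]] by simp
qed

text \<open>The real part of the form is Re b (|p|^2 - m) + Re a m, where m = |x . p|^2 / s lies
  between 0 and |p|^2 by Cauchy-Schwarz; so \<open>lam\<close> bounds both weights. The constant 3 M
  is the sum of M for b and 2 M for a - b.\<close>

lemma uniformly_elliptic_coeff: "uniformly_elliptic coeff lam (3 * M)"
  unfolding uniformly_elliptic_def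
proof (intro allI conjI)
  fix x :: "real^'n" and p :: "complex^'n"
  define s where "s = (norm x)\<^sup>2"
  have s: "s \<ge> 0" by (simp add: s_def)
  define P where "P = (\<Sum>l\<in>UNIV. of_real (x $ l) * p $ l)"
  have norm_p: "(\<Sum>l\<in>UNIV. p $ l * cnj (p $ l)) = of_real ((norm p)\<^sup>2)"
    by (simp add: norm_vec_def L2_set_def sum_nonneg complex_norm_square[symmetric])
  have P_le: "(cmod P)\<^sup>2 \<le> s * (norm p)\<^sup>2"
    using power_mono[OF norm_sum_of_real_mult_le[of x p], of 2]
    by (simp add: P_def s_def power_mult_distrib)
  define m where "m = (cmod P)\<^sup>2 / s"
  have m: "0 \<le> m" "m \<le> (norm p)\<^sup>2"
    using P_le s by (auto simp: m_def divide_le_eq mult.commute)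
  have cnjP: "cnj P = (\<Sum>l\<in>UNIV. of_real (x $ l) * cnj (p $ l))"
    by (simp add: P_def)
  have "(\<Sum>k\<in>UNIV. \<Sum>l\<in>UNIV. coeff x $ k $ l * p $ k * cnj (p $ l))
      = (\<Sum>k\<in>UNIV. \<Sum>l\<in>UNIV. if k = l then b s * (p $ l * cnj (p $ l)) else 0)
      + (\<Sum>k\<in>UNIV. \<Sum>l\<in>UNIV. (a s - b s) * of_real (1 / s) * ((of_real (x $ k) * p $ k)
          * (of_real (x $ l) * cnj (p $ l))))"
    unfolding sum.distrib[symmetric]
    by (intro sum.cong) (auto simp: coeff_def s_def[symmetric] algebra_simps diff_divide_distrib)
  also have "\<dots> = b s * (\<Sum>l\<in>UNIV. p $ l * cnj (p $ l)) + (a s - b s) * of_real (1 / s) * (P * cnj P)"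
    unfolding cnjP unfolding P_def sum_product by (simp add: sum_distrib_left)
  also have "\<dots> = b s * of_real ((norm p)\<^sup>2) + (a s - b s) * of_real m"
    unfolding norm_p unfolding complex_norm_square[symmetric] by (simp add: m_def)
  finally have eq: "(\<Sum>k\<in>UNIV. \<Sum>l\<in>UNIV. coeff x $ k $ l * p $ k * cnj (p $ l))
      = b s * of_real ((norm p)\<^sup>2) + (a s - b s) * of_real m" .
  have "Re (\<Sum>k\<in>UNIV. \<Sum>l\<in>UNIV. coeff x $ k $ l * p $ k * cnj (p $ l))
      = Re (b s) * ((norm p)\<^sup>2 - m) + Re (a s) * m"
    unfolding eq by (simp add: algebra_simps del: of_real_power)
  moreover have "Re (b s) * ((norm p)\<^sup>2 - m) + Re (a s) * m \<ge> lam * ((norm p)\<^sup>2 - m) + lam * m"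
    using m lower(2,3)[OF s] by (intro add_mono mult_right_mono) auto
  ultimately show "lam * (norm p)\<^sup>2 \<le> Re (\<Sum>k\<in>UNIV. \<Sum>l\<in>UNIV. coeff x $ k $ l * p $ k * cnj (p $ l))"
    by (simp add: algebra_simps)
  define X :: "complex^'n" where "X = (\<chi> k. of_real (x $ k))"
  have norm_X: "norm X = norm x"
    by (simp add: X_def norm_vec_def L2_set_def)
  have "coeff x *v p = b s *s p + ((a s - b s) * of_real (1 / s) * P) *s X"
  proof -
    have "(\<Sum>l\<in>UNIV. coeff x $ k $ l * p $ l)
      = (\<Sum>l\<in>UNIV. if k = l then b s * p $ l else 0)
      + (\<Sum>l\<in>UNIV. (a s - b s) * of_real (1 / s) * of_real (x $ k) * (of_real (x $ l) * p $ l))" for k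
      unfolding sum.distrib[symmetric]
      by (intro sum.cong) (auto simp: coeff_def s_def[symmetric] algebra_simps diff_divide_distrib)
    then show ?thesis
      unfolding sum_distrib_left[symmetric]
      by (simp add: vec_eq_iff matrix_vector_mult_def X_def P_def)
  qed
  moreover have norm_smult: "norm (c *s v) = cmod c * norm v" for c and v :: "complex^'n"
    by (simp add: norm_vec_def L2_set_def norm_mult power_mult_distrib sum_distrib_left[symmetric]
        real_sqrt_mult)
  ultimately have "norm (coeff x *v p)
      \<le> cmod (b s) * norm p + cmod (a s - b s) * (1 / s) * cmod P * norm x"
    using norm_triangle_ineq[of "b s *s p" "((a s - b s) * of_real (1 / s) * P) *s X"] s
    by (simp add: norm_X norm_mult norm_divide)
  also have "\<dots> \<le> M * norm p + (M + M) * norm p"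
  proof (intro add_mono mult_right_mono)
    have "(1 / s) * cmod P * norm x \<le> (1 / s) * (norm x * norm p) * norm x"
      unfolding P_def using s by (intro mult_right_mono mult_left_mono norm_sum_of_real_mult_le) auto
    also have "\<dots> \<le> norm p"
      by (cases "x = 0") (auto simp: s_def power2_eq_square)
    finally have "(1 / s) * cmod P * norm x \<le> norm p" .
    moreover have "cmod (a s - b s) \<le> M + M"
      using norm_triangle_ineq4[of "a s" "b s"] upper[OF s] by linarith
    ultimately have "cmod (a s - b s) * ((1 / s) * cmod P * norm x) \<le> (M + M) * norm p"
      using M_pos s by (intro mult_mono) auto
    then show "cmod (a s - b s) * (1 / s) * cmod P * norm x \<le> (M + M) * norm p"
      by (simp add: mult.assoc)
  qed (use upper[OF s] in auto)
  finally have "norm (coeff x *v p) \<le> (3 * M) * norm p"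
    by (simp add: algebra_simps)
  then have "(norm (coeff x *v p))\<^sup>2 \<le> ((3 * M) * norm p)\<^sup>2"
    by (rule power_mono) simp
  then show "(norm (coeff x *v p))\<^sup>2 \<le> (3 * M)\<^sup>2 * (norm p)\<^sup>2"
    by (simp only: power_mult_distrib)
qed

text \<open>When H has no zeros, \<open>sol\<close> vanishes only on a coordinate hyperplane, which
  is a null set.\<close>

lemma sol_nontrivial:
  assumes "\<And>s. s \<ge> 0 \<Longrightarrow> H s \<noteq> 0"
  shows "\<not> (AE x in lebesgue. sol x = 0)"
proof
  assume "AE x in lebesgue. sol x = 0"
  moreover have "sol x = 0 \<longleftrightarrow> x $ k0 = 0" for x
    using assms by (simp add: sol_def)
  moreover have "negligible {x::real^'n. x $ k0 = 0}"
    by (rule negligible_standard_hyperplane_cart)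
  then have "AE x in lebesgue. x \<notin> {x::real^'n. x $ k0 = 0}"
    by (intro AE_not_in) (simp add: negligible_iff_null_sets)
  ultimately have "AE x::real^'n in lebesgue. False"
    by (auto elim: AE_mp)
  then show False
    by (simp add: ae_filter_eq_bot_iff trivial_limit_def[symmetric])
qed

end

section \<open>A class of smooth functions closed under differentiation\<close>

text \<open>The rule \<open>power\<close> provides complex powers of a positive quadratic.
  Reciprocals are its case z = -1, so derivatives stay in the class without a quotient rule, and
  smoothness follows by induction on the order.\<close>

inductive elementary :: "(real \<Rightarrow> complex) \<Rightarrow> bool" where
  const: "elementary (\<lambda>_. c)"
| ident: "elementary of_real"
| power: "\<kappa> > 0 \<Longrightarrow> \<nu> \<ge> 0 \<Longrightarrow> elementary (\<lambda>s. exp (z * of_real (ln (\<kappa> + \<nu> * s\<^sup>2))))"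
| add: "elementary f \<Longrightarrow> elementary g \<Longrightarrow> elementary (\<lambda>s. f s + g s)"
| mult: "elementary f \<Longrightarrow> elementary g \<Longrightarrow> elementary (\<lambda>s. f s * g s)"

lemma elementary_diff:
  assumes "elementary f" "elementary g"
  shows "elementary (\<lambda>s. f s - g s)"
  using elementary.add[OF assms(1) elementary.mult[OF elementary.const[of "-1"] assms(2)]] by simp

lemmas elementary_intros = elementary.intros elementary_diff

lemma has_vector_derivative_exp_ln:
  fixes z :: complex
  assumes "\<kappa> > 0" "\<nu> \<ge> 0"
  shows "((\<lambda>s. exp (z * of_real (ln (\<kappa> + \<nu> * s\<^sup>2)))) has_vector_derivative
    of_real (2 * \<nu> * s / (\<kappa> + \<nu> * s\<^sup>2)) * z * exp (z * of_real (ln (\<kappa> + \<nu> * s\<^sup>2)))) (at s)"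
proof -
  have pos: "\<kappa> + \<nu> * s\<^sup>2 > 0"
    using assms by (simp add: add_pos_nonneg)
  have "((\<lambda>s. ln (\<kappa> + \<nu> * s\<^sup>2)) has_real_derivative (2 * \<nu> * s / (\<kappa> + \<nu> * s\<^sup>2))) (at s)"
    using pos by (auto intro!: derivative_eq_intros)
  then have "((\<lambda>s. z * complex_of_real (ln (\<kappa> + \<nu> * s\<^sup>2))) has_vector_derivative
      z * of_real (2 * \<nu> * s / (\<kappa> + \<nu> * s\<^sup>2))) (at s)"
    by (intro has_vector_derivative_mult_right has_vector_derivative_of_real)
  from field_vector_diff_chain_at[OF this DERIV_exp] show ?thesis
    by (simp add: o_def mult_ac)
qed

lemma elementary_derivative:
  assumes "elementary f"
  shows "\<exists>f'. elementary f' \<and> (\<forall>s. (f has_vector_derivative f' s) (at s))"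
  using assms
proof induction
  case (const c)
  show ?case
    by (rule exI[of _ "\<lambda>_. 0"]) (auto intro: elementary.const)
next
  case ident
  have "(of_real has_vector_derivative (1::complex)) (at s)" for s
    using has_vector_derivative_of_real[OF DERIV_ident] by simp
  then show ?case
    by (intro exI[of _ "\<lambda>_. 1"]) (auto intro: elementary.const)
next
  case (power \<kappa> \<nu> z)
  let ?e = "\<lambda>z s. exp (z * complex_of_real (ln (\<kappa> + \<nu> * s\<^sup>2)))"
  have "of_real (2 * \<nu> * s / (\<kappa> + \<nu> * s\<^sup>2)) * z * ?e z s
      = (of_real (2 * \<nu>) * z) * of_real s * (?e (-1) s * ?e z s)" for s
  proof -
    have "\<kappa> + \<nu> * s\<^sup>2 > 0"
      using power by (simp add: add_pos_nonneg)
    then have "?e (-1) s = of_real (1 / (\<kappa> + \<nu> * s\<^sup>2))"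
      by (simp add: exp_of_real exp_minus exp_ln inverse_eq_divide flip: of_real_minus)
    then show ?thesis by (simp only: of_real_mult of_real_divide) simp
  qed
  then show ?case
    using has_vector_derivative_exp_ln[of \<kappa> \<nu> z] power elementary.power[of \<kappa> \<nu> "-1"]
    by (intro exI[of _ "\<lambda>s. (of_real (2 * \<nu>) * z) * of_real s * (?e (-1) s * ?e z s)"])
      (auto intro!: elementary_intros)
next
  case (add f g)
  then obtain f' g' where "elementary f'" "elementary g'"
    "\<And>s. (f has_vector_derivative f' s) (at s)" "\<And>s. (g has_vector_derivative g' s) (at s)"
    by blast
  then show ?case
    by (intro exI[of _ "\<lambda>s. f' s + g' s"]) (auto intro: elementary_intros has_vector_derivative_add)
next
  case (mult f g)
  then obtain f' g' where "elementary f'" "elementary g'"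
    "\<And>s. (f has_vector_derivative f' s) (at s)" "\<And>s. (g has_vector_derivative g' s) (at s)"
    by blast
  then show ?case
    using mult.hyps
    by (intro exI[of _ "\<lambda>s. f s * g' s + f' s * g s"])
      (auto intro!: elementary_intros has_vector_derivative_mult)
qed

lemma elementary_continuous: "elementary f \<Longrightarrow> continuous_on S f"
  by (meson elementary_derivative has_vector_derivative_continuous continuous_at_imp_continuous_on)

lemma elementary_Ck_on: "elementary f \<Longrightarrow> Ck_on k UNIV f"
proof (induction k arbitrary: f)
  case 0
  then show ?case by (simp add: elementary_continuous)
next
  case (Suc k)
  obtain f' where f': "elementary f'" "\<And>s. (f has_vector_derivative f' s) (at s)"
    using elementary_derivative[OF Suc.prems] by blast
  have D: "(f has_derivative (\<lambda>x. x *\<^sub>R f' s)) (at s)" for s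
    using f'(2) by (simp add: has_vector_derivative_def)
  have "frechet_derivative f (at s) 1 = f' s" for s
    using frechet_derivative_at[OF D[of s]] by (metis scaleR_one)
  moreover have "f differentiable_on UNIV"
    using D by (auto simp: differentiable_on_def differentiable_def)
  ultimately show ?case
    using Suc.IH[OF f'(1)] by simp
qed

lemma elementary_smooth: "elementary f \<Longrightarrow> smooth_on UNIV f"
  by (simp add: smooth_on_def elementary_Ck_on)

lemma Ck_on_const: "Ck_on k UNIV (\<lambda>_. c)"
  by (induction k arbitrary: c) (simp_all add: frechet_derivative_const)

lemma smooth_on_bounded_linear:
  assumes "bounded_linear f"
  shows "smooth_on UNIV f"
proof -
  have "Ck_on k UNIV f" for k
  proof (cases k)
    case 0
    then show ?thesis using assms by (simp add: linear_continuous_on)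
  next
    case (Suc m)
    have D: "(f has_derivative f) (at x)" for x
      using assms by (rule bounded_linear_imp_has_derivative)
    then have "frechet_derivative f (at x) = f" for x
      by (metis frechet_derivative_at)
    moreover have "f differentiable_on UNIV"
      using D by (auto simp: differentiable_on_def differentiable_def)
    ultimately show ?thesis
      using Suc by (simp add: Ck_on_const)
  qed
  then show ?thesis by (simp add: smooth_on_def)
qed

section \<open>The explicit profile\<close>

text \<open>The right-hand side is \<open>(n - 1) Re b\<close>, where \<open>\<theta> = s\<^sup>2/(d + s\<^sup>2)\<close>, \<open>\<Theta> = s\<^sup>2/(1 + s\<^sup>2)\<close>,
  \<open>\<nu> = (1 + s\<^sup>2) powr (-1/2)\<close>, \<open>\<rho> = s \<nu>\<close>, \<open>N = 1 + c \<nu>\<close>, \<open>e = s (1 - \<theta>)\<close> and \<open>x = Re q\<close>. For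
  \<open>\<Theta> \<le> \<delta>/32\<close> the terms with factor \<open>x\<close> suffice; otherwise the term with \<open>\<rho>\<close> absorbs \<open>-2 x \<Theta>\<close>.\<close>

lemma tangential_estimate:
  fixes n \<mu> \<delta> x \<theta> \<Theta> \<nu> \<rho> N e :: real
  assumes "0 \<le> \<mu>" "0 < \<delta>" "\<delta> \<le> 1" "\<delta> \<le> n - 2 * \<mu>" "n \<ge> 2"
    and \<theta>: "0 \<le> \<theta>" "\<theta> \<le> 1" and \<Theta>: "0 \<le> \<Theta>" "\<Theta> \<le> 1"
    and \<nu>: "0 \<le> \<nu>" "\<nu> \<le> 1" and \<rho>: "\<Theta> \<le> \<rho>" and N: "1 \<le> N" "N \<le> 2"
    and x: "0 < x" "x \<le> \<delta>\<^sup>2 / 4096"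
    and e: "(1 + \<mu>) * e / 2 \<le> x * \<delta> / 16"
  shows "x * \<delta> / 16 \<le> x * ((2 - \<delta> / 2) * (\<theta> - \<Theta>) + n - 1 - (2 * \<mu> + 1 + \<delta> / 4) * \<theta>
      - \<delta> / 16 * (\<Theta> * \<nu> / N)) - ((1 + \<mu>) * e - \<delta> / 16 * (\<Theta> * \<rho> / N)) / 2"
proof -
  define \<psi> where "\<psi> = \<Theta> * \<nu> / N"
  let ?B = "(2 - \<delta> / 2) * (\<theta> - \<Theta>) + n - 1 - (2 * \<mu> + 1 + \<delta> / 4) * \<theta> - \<delta> / 16 * \<psi>"
  have "\<psi> \<le> 1"
    using mult_mono[OF \<Theta>(2) \<nu>(2)] \<nu> N by (simp add: \<psi>_def divide_le_eq)
  \<comment> \<open>The bracket is rearranged as a combination of 1 - \<theta>, \<theta>, \<Theta>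
    and 1 - \<psi> with nonnegative coefficients. The one of \<theta> is where the gap \<delta>
    \<le> n - 2 \<mu> enters.\<close>
  then have "0 \<le> (n - 1 - \<delta> / 4) * (1 - \<theta>) + (n - 2 * \<mu> - \<delta>) * \<theta> + \<delta> / 2 * \<Theta> + \<delta> / 16 * (1 - \<psi>)"
    using assms by (intro add_nonneg_nonneg mult_nonneg_nonneg) auto
  also have "\<dots> = ?B - (3 * \<delta> / 16 - 2 * \<Theta>)"
    by (simp add: field_simps)
  finally have "3 * \<delta> / 16 - 2 * \<Theta> \<le> ?B" by simp
  then have B: "x * (3 * \<delta> / 16 - 2 * \<Theta>) \<le> x * ?B"
    using x by (intro mult_left_mono) auto
  have "\<Theta> * \<Theta> / 2 \<le> \<Theta> * \<rho> / N"
    using \<Theta> \<rho> N by (intro frac_le mult_mono) auto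
  then have R: "\<delta> / 16 * (\<Theta> * \<Theta> / 2) \<le> \<delta> / 16 * (\<Theta> * \<rho> / N)"
    using assms by (intro mult_left_mono) auto
  \<comment> \<open>The bound on x is made for this: beyond the threshold \<delta>/32, twice
    \<delta>^2/4096 equals \<delta>/64 times \<delta>/32, so the quadratic term dominates 2 x
    \<Theta>.\<close>
  have T: "0 \<le> x * (\<delta> / 16 - 2 * \<Theta>) + \<delta> / 64 * (\<Theta> * \<Theta>)"
  proof (cases "\<Theta> \<le> \<delta> / 32")
    case True
    then have "0 \<le> x * (\<delta> / 16 - 2 * \<Theta>)" "0 \<le> \<delta> / 64 * (\<Theta> * \<Theta>)"
      using x assms by auto
    then show ?thesis by linarith
  next
    case False
    then have "\<delta> / 64 * (\<Theta> * (\<delta> / 32)) \<le> \<delta> / 64 * (\<Theta> * \<Theta>)"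
      using \<Theta> assms by (intro mult_left_mono) auto
    moreover have "x * (2 * \<Theta>) \<le> \<delta>\<^sup>2 / 4096 * (2 * \<Theta>)"
      using x \<Theta> by (intro mult_right_mono) auto
    moreover have "0 \<le> x * \<delta>" using x assms by simp
    ultimately show ?thesis by (simp add: algebra_simps power2_eq_square)
  qed
  \<comment> \<open>The three portions x \<delta>/16 have separate uses: one pays for e, one goes
    into \<open>T\<close>, and one is left as the lower bound.\<close>
  have "x * \<delta> / 16 \<le> (x * \<delta> / 16 - (1 + \<mu>) * e / 2)
      + (x * (\<delta> / 16 - 2 * \<Theta>) + \<delta> / 64 * (\<Theta> * \<Theta>)) + x * \<delta> / 16"
    unfolding le_add_same_cancel2 by (rule add_nonneg_nonneg[OF _ T]) (use e in simp)
  also have "\<dots> = x * (3 * \<delta> / 16 - 2 * \<Theta>) - ((1 + \<mu>) * e - \<delta> / 16 * (\<Theta> * \<Theta> / 2)) / 2"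
    by (simp add: field_simps)
  also have "\<dots> \<le> x * ?B - ((1 + \<mu>) * e - \<delta> / 16 * (\<Theta> * \<rho> / N)) / 2"
    using R by (intro diff_mono B divide_right_mono) auto
  finally show ?thesis by (simp only: \<psi>_def)
qed

text \<open>Here \<open>\<sigma> = 1 + 2 s H'/H\<close>, so that \<open>a = q/\<sigma>\<close>.\<close>

lemma radial_estimate:
  fixes \<mu> \<delta> \<theta> \<xi> x :: real
  assumes "0 \<le> \<mu>" "0 < \<delta>" "\<delta> \<le> 1" and \<theta>: "0 \<le> \<theta>" "\<theta> \<le> 1"
    and \<xi>: "- (\<delta> / 16) \<le> \<xi>" "\<xi> \<le> 0" and x: "0 < x" "x \<le> 1"
  defines "\<sigma> \<equiv> 1 - Complex (\<mu> + 1) 1 * of_real \<theta> + of_real \<xi>"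
    and "q \<equiv> of_real x * Complex 1 (- (\<mu> + \<delta> / 4))"
  shows "\<sigma> \<noteq> 0" and "cmod \<sigma> \<le> \<mu> + 4" and "cmod q \<le> \<mu> + 2"
    and "x * (\<delta> / 8) / (\<mu> + 4)\<^sup>2 \<le> Re (q / \<sigma>)" and "cmod (q / \<sigma>) \<le> 8 * (\<mu> + 2)\<^sup>2 / \<delta>"
proof -
  define Q where "Q = Complex 1 (- (\<mu> + \<delta> / 4))"
  have cQ: "cmod Q \<le> \<mu> + 2"
    using cmod_le[of Q] assms by (simp add: Q_def)
  \<comment> \<open>The sign of Re (q/\<sigma>) is that of Re (Q cnj \<sigma>). The imaginary part
    of Q contributes (\<mu> + \<delta>/4) \<theta>, which offsets the loss (\<mu> + 1) \<theta> in
    Re \<sigma> up to (1 - \<delta>/4) \<theta>; this leaves \<delta>/4 to absorb \<xi>.\<close>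
  have "Re (Q * cnj \<sigma>) = 1 - (1 - \<delta> / 4) * \<theta> + \<xi>"
    by (simp add: Q_def \<sigma>_def algebra_simps)
  moreover have "(1 - \<delta> / 4) * \<theta> \<le> (1 - \<delta> / 4) * 1"
    using assms by (intro mult_left_mono) auto
  ultimately have re: "\<delta> / 8 \<le> Re (Q * cnj \<sigma>)"
    using \<xi> \<open>0 < \<delta>\<close> by (simp add: algebra_simps)
  then show \<sigma>0: "\<sigma> \<noteq> 0"
    using \<open>0 < \<delta>\<close> by force
  \<comment> \<open>The same positivity keeps \<sigma> away from 0, which yields the upper bound for
    the quotient.\<close>
  have "\<delta> / 8 \<le> cmod Q * cmod \<sigma>"
    using re complex_Re_le_cmod[of "Q * cnj \<sigma>"] by (simp add: norm_mult)
  also have "\<dots> \<le> (\<mu> + 2) * cmod \<sigma>"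
    using cQ by (intro mult_right_mono) auto
  finally have low: "\<delta> / 8 \<le> (\<mu> + 2) * cmod \<sigma>" .
  have "cmod \<sigma> \<le> \<bar>Re \<sigma>\<bar> + \<bar>Im \<sigma>\<bar>" by (rule cmod_le)
  moreover have "\<bar>1 - t + \<xi>\<bar> \<le> \<mu> + 3" if "0 \<le> t" "t \<le> \<mu> + 1" for t
    using that \<xi> \<open>0 \<le> \<mu>\<close> \<open>\<delta> \<le> 1\<close> by (intro abs_leI) linarith+
  then have "\<bar>1 - (\<mu> + 1) * \<theta> + \<xi>\<bar> \<le> \<mu> + 3"
    using \<theta> \<open>0 \<le> \<mu>\<close> by (simp add: mult_left_le)
  ultimately show up: "cmod \<sigma> \<le> \<mu> + 4"
    using \<theta> by (simp add: \<sigma>_def)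
  have "x * cmod Q \<le> 1 * (\<mu> + 2)"
    using x cQ by (intro mult_mono) auto
  then show cq: "cmod q \<le> \<mu> + 2"
    using x by (simp add: q_def Q_def norm_mult)
  have "Re (q / \<sigma>) = x * Re (Q * cnj \<sigma>) / (cmod \<sigma>)\<^sup>2"
    by (simp add: q_def Q_def complex_div_cnj[of _ \<sigma>] algebra_simps)
  moreover have "x * (\<delta> / 8) / (\<mu> + 4)\<^sup>2 \<le> x * Re (Q * cnj \<sigma>) / (cmod \<sigma>)\<^sup>2"
    using re x up \<sigma>0 assms(2) by (intro frac_le mult_mono power_mono) auto
  ultimately show "x * (\<delta> / 8) / (\<mu> + 4)\<^sup>2 \<le> Re (q / \<sigma>)" by simp
  have "cmod (q / \<sigma>) = cmod q / cmod \<sigma>" by (simp add: norm_divide)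
  also have "\<dots> \<le> 8 * (\<mu> + 2)\<^sup>2 / \<delta>"
  proof -
    have "cmod q * \<delta> \<le> (\<mu> + 2) * (8 * ((\<mu> + 2) * cmod \<sigma>))"
      using cq low assms by (intro mult_mono) auto
    then show ?thesis
      using \<sigma>0 \<open>0 < \<delta>\<close> by (simp add: divide_simps power2_eq_square)
  qed
  finally show "cmod (q / \<sigma>) \<le> 8 * (\<mu> + 2)\<^sup>2 / \<delta>" .
qed

text \<open>The exponent on the right falls short of 1/2 by \<delta>/8, so d^(1/2) is smaller by the
  factor d^(\<delta>/8). Taking d = C^(8/\<delta>) makes that factor equal to C. The left side will
  bound the drift error near s = sqrt d, and the right side comes from the least value of Re
  q.\<close>

lemma small_parameter_exists:
  fixes \<mu> \<delta> :: real
  assumes "0 \<le> \<mu>" "0 < \<delta>"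
  obtains d where "0 < d" "d \<le> 1"
    "(1 + \<mu>) * sqrt d / 4 \<le> \<delta>\<^sup>2 / 4096 * d powr ((1 - \<delta> / 4) / 2) * \<delta> / 16"
proof
  define X where "X = \<delta>\<^sup>2 / 4096"
  define C where "C = min 1 (X * \<delta> / (4 * (1 + \<mu>)))"
  define d where "d = C powr (8 / \<delta>)"
  have C: "0 < C" "C \<le> 1" "C \<le> X * \<delta> / (4 * (1 + \<mu>))"
    using assms by (auto simp: C_def X_def)
  show d: "0 < d" "d \<le> 1"
    using C assms by (auto simp: d_def powr_le1)
  have "sqrt d = d powr ((1 - \<delta> / 4) / 2 + \<delta> / 8)"
    using d by (simp add: powr_half_sqrt[symmetric] field_simps)
  also have "\<dots> = d powr ((1 - \<delta> / 4) / 2) * C"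
    using C assms by (simp add: powr_add) (simp add: d_def powr_powr)
  finally have "(1 + \<mu>) * sqrt d / 4 = (1 + \<mu>) / 4 * d powr ((1 - \<delta> / 4) / 2) * C" by simp
  also have "\<dots> \<le> (1 + \<mu>) / 4 * d powr ((1 - \<delta> / 4) / 2) * (X * \<delta> / (4 * (1 + \<mu>)))"
    using C assms by (intro mult_left_mono) auto
  also have "\<dots> = X * d powr ((1 - \<delta> / 4) / 2) * \<delta> / 16"
    using assms by (simp add: field_simps)
  finally show "(1 + \<mu>) * sqrt d / 4 \<le> \<delta>\<^sup>2 / 4096 * d powr ((1 - \<delta> / 4) / 2) * \<delta> / 16"
    by (simp add: X_def)
qed

text \<open>The quotient (d + s^2) / (1 + s^2) lies between d and 1; its p-th power is written with
  logarithms to match the complex powers in the profile.\<close>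

lemma weight_bounds:
  fixes d p s :: real
  assumes "0 < d" "d \<le> 1" "0 \<le> p"
  shows "d powr p \<le> exp (p * ln (d + s\<^sup>2)) * exp (- p * ln (1 + s\<^sup>2))"
    and "exp (p * ln (d + s\<^sup>2)) * exp (- p * ln (1 + s\<^sup>2)) \<le> 1"
proof -
  have pos: "0 < d + s\<^sup>2" "0 < 1 + s\<^sup>2"
    using assms by (auto simp: add_pos_nonneg)
  have "d * (1 + s\<^sup>2) \<le> d + s\<^sup>2"
    using assms by (simp add: algebra_simps mult_left_le_one_le)
  then have "ln (d * (1 + s\<^sup>2)) \<le> ln (d + s\<^sup>2)"
    using assms pos by (intro ln_mono) auto
  then have "ln d \<le> ln (d + s\<^sup>2) - ln (1 + s\<^sup>2)"
    using assms pos by (simp add: ln_mult)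
  then have "p * ln d \<le> p * (ln (d + s\<^sup>2) - ln (1 + s\<^sup>2))"
    using assms by (intro mult_left_mono)
  then show "d powr p \<le> exp (p * ln (d + s\<^sup>2)) * exp (- p * ln (1 + s\<^sup>2))"
    using assms by (simp add: powr_def exp_add[symmetric] algebra_simps)
  have "p * ln (d + s\<^sup>2) \<le> p * ln (1 + s\<^sup>2)"
    using assms pos by (intro mult_left_mono ln_mono) auto
  then show "exp (p * ln (d + s\<^sup>2)) * exp (- p * ln (1 + s\<^sup>2)) \<le> 1"
    by (simp add: exp_add[symmetric])
qed

text \<open>These are the values at a fixed s: q/\<sigma> will be a, and B will be (n - 1) b. In B,
  the first term comes from differentiating the weight in q, the next two from the flux and the
  derivative of H, and the last from the drift.\<close>

lemma coefficient_bounds: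
  fixes n \<mu> \<delta> d s :: real
  assumes par: "0 \<le> \<mu>" "0 < \<delta>" "\<delta> \<le> 1" "\<delta> \<le> n - 2 * \<mu>" "n \<ge> 2" "0 < d" "d \<le> 1"
    and small: "(1 + \<mu>) * sqrt d / 4 \<le> \<delta>\<^sup>2 / 4096 * d powr ((1 - \<delta> / 4) / 2) * \<delta> / 16"
    and s: "0 \<le> s"
  defines "\<theta> \<equiv> s\<^sup>2 / (d + s\<^sup>2)" and "\<Theta> \<equiv> s\<^sup>2 / (1 + s\<^sup>2)"
    and "\<nu> \<equiv> exp (- (1/2) * ln (1 + s\<^sup>2))"
    and "x0 \<equiv> \<delta>\<^sup>2 / 4096 * d powr ((1 - \<delta> / 4) / 2)"
    and "x \<equiv> \<delta>\<^sup>2 / 4096 * (exp ((1 - \<delta> / 4) / 2 * ln (d + s\<^sup>2)) * exp (- ((1 - \<delta> / 4) / 2) * ln (1 + s\<^sup>2)))"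
  defines "N \<equiv> 1 + \<delta> / 32 * \<nu>"
  defines "\<xi> \<equiv> - (\<delta> / 16 * (\<Theta> * \<nu> / N))"
  defines "\<sigma> \<equiv> 1 - Complex (\<mu> + 1) 1 * of_real \<theta> + of_real \<xi>"
    and "q \<equiv> of_real x * Complex 1 (- (\<mu> + \<delta> / 4))"
  defines "B \<equiv> of_real (2 * (1 - \<delta> / 4) * (\<theta> - \<Theta>)) * q + q * \<sigma> + of_real (n - 2) * q
      - of_real (s / 2) * (\<sigma> + Complex \<mu> 1)"
  shows "\<sigma> \<noteq> 0"
    and "x0 * (\<delta> / 8) / (\<mu> + 4)\<^sup>2 \<le> Re (q / \<sigma>)" and "cmod (q / \<sigma>) \<le> 8 * (\<mu> + 2)\<^sup>2 / \<delta>"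
    and "x0 * \<delta> / 16 \<le> Re B" and "cmod B \<le> (\<mu> + 2) * (2 + (\<mu> + 4) + (n - 2)) + (\<mu> + 3)"
proof -
  have pos: "0 < d + s\<^sup>2" "0 < 1 + s\<^sup>2"
    using par by (auto simp: add_pos_nonneg)
  have \<theta>: "0 \<le> \<theta>" "\<theta> \<le> 1" and \<Theta>: "0 \<le> \<Theta>" "\<Theta> \<le> 1"
    using par pos by (auto simp: \<theta>_def \<Theta>_def divide_le_eq)
  have \<nu>: "0 < \<nu>" "\<nu> \<le> 1"
    by (auto simp: \<nu>_def)
  have \<nu>2: "\<nu>\<^sup>2 = 1 / (1 + s\<^sup>2)"
  proof -
    have "\<nu>\<^sup>2 = exp (- ln (1 + s\<^sup>2))"
      by (simp add: \<nu>_def power2_eq_square exp_add[symmetric])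
    then show ?thesis using pos by (simp add: exp_minus inverse_eq_divide)
  qed
  define \<rho> where "\<rho> = s * \<nu>"
  have \<rho>2: "\<rho>\<^sup>2 = \<Theta>"
    by (simp add: \<rho>_def \<Theta>_def power_mult_distrib \<nu>2)
  have \<rho>0: "0 \<le> \<rho>" using s \<nu> by (simp add: \<rho>_def)
  have \<rho>1: "\<rho> \<le> 1"
    using \<rho>2 \<Theta>(2) by (intro power2_le_imp_le[of \<rho> 1]) auto
  have \<rho>: "\<Theta> \<le> \<rho>"
    using \<rho>0 \<rho>1 by (simp add: \<rho>2[symmetric] power2_eq_square mult_left_le)
  have N: "1 \<le> N" "N \<le> 2"
    using par \<nu> mult_mono[of "\<delta> / 32" 1 \<nu> 1] by (auto simp: N_def)
  have "x0 \<le> x" and x1: "x \<le> \<delta>\<^sup>2 / 4096"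
    using weight_bounds[of d "(1 - \<delta> / 4) / 2" s] par
    by (auto simp: x0_def x_def intro!: mult_left_mono mult_left_le)
  moreover have x00: "0 < x0"
    using par by (simp add: x0_def)
  ultimately have x: "0 < x" "x0 \<le> x" by auto
  have "\<delta>\<^sup>2 \<le> 1"
    using par by (simp add: power_le_one)
  then have x2: "x \<le> 1" using x1 by simp
  define e where "e = s * (1 - \<theta>)"
  have e_eq: "e = s * d / (d + s\<^sup>2)"
    using pos by (simp add: e_def \<theta>_def field_simps)
  \<comment> \<open>This is the arithmetic-geometric mean inequality for s and sqrt d.\<close>
  have e: "0 \<le> e" "e \<le> sqrt d / 2"
  proof -
    have "0 \<le> (s - sqrt d)\<^sup>2" by simp
    then have "2 * (s * sqrt d) \<le> d + s\<^sup>2"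
      using par by (simp add: power2_diff)
    then have "2 * (s * sqrt d) * sqrt d \<le> (d + s\<^sup>2) * sqrt d"
      using par by (intro mult_right_mono) auto
    moreover have "2 * (s * sqrt d) * sqrt d = 2 * (s * d)"
      using par by (simp add: mult.assoc)
    ultimately have "2 * (s * d) \<le> (d + s\<^sup>2) * sqrt d"
      by (simp only:)
    then have "s * d \<le> sqrt d / 2 * (d + s\<^sup>2)"
      by (simp add: mult.commute)
    then show "e \<le> sqrt d / 2"
      using pos by (simp only: e_eq pos_divide_le_eq)
    show "0 \<le> e" using s par pos by (simp add: e_eq)
  qed
  have e1: "e \<le> 1"
    using e(2) real_sqrt_le_1_iff[of d] par by linarith
  \<comment> \<open>The smallness of d is spent here: the drift error is charged to the least value
    of Re q.\<close>
  have "(1 + \<mu>) * e / 2 \<le> (1 + \<mu>) * (sqrt d / 2) / 2"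
    using par e by (intro divide_right_mono mult_left_mono) auto
  also have "\<dots> \<le> x0 * \<delta> / 16"
    using small by (simp add: x0_def)
  also have "\<dots> \<le> x * \<delta> / 16"
    using x par by (intro divide_right_mono mult_right_mono) auto
  finally have e2: "(1 + \<mu>) * e / 2 \<le> x * \<delta> / 16" .
  have f1: "0 \<le> \<Theta> * \<nu> / N" "\<Theta> * \<nu> / N \<le> 1"
    using \<Theta> \<nu> N mult_mono[of \<Theta> 1 \<nu> 1] by (auto simp: divide_le_eq)
  have f2: "0 \<le> \<Theta> * \<rho> / N" "\<Theta> * \<rho> / N \<le> 1"
    using \<Theta> \<rho>0 \<rho>1 N mult_mono[of \<Theta> 1 \<rho> 1] by (auto simp: divide_le_eq)
  have \<delta>_mult: "0 \<le> \<delta> / 16 * t" "\<delta> / 16 * t \<le> \<delta> / 16" if "0 \<le> t" "t \<le> 1" for t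
    using that par by auto
  have \<xi>: "- (\<delta> / 16) \<le> \<xi>" "\<xi> \<le> 0"
    using \<delta>_mult[OF f1] unfolding \<xi>_def by linarith+
  have s\<xi>: "s * \<xi> = - (\<delta> / 16 * (\<Theta> * \<rho> / N))"
    by (simp add: \<xi>_def \<rho>_def)
  note rad = radial_estimate[OF par(1-3) \<theta> \<xi> x(1) x2, folded \<sigma>_def q_def]
  show "\<sigma> \<noteq> 0" "cmod (q / \<sigma>) \<le> 8 * (\<mu> + 2)\<^sup>2 / \<delta>"
    by (fact rad)+
  have "x0 * (\<delta> / 8) / (\<mu> + 4)\<^sup>2 \<le> x * (\<delta> / 8) / (\<mu> + 4)\<^sup>2"
    using x par by (intro divide_right_mono mult_right_mono) auto
  then show "x0 * (\<delta> / 8) / (\<mu> + 4)\<^sup>2 \<le> Re (q / \<sigma>)"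
    using rad(4) by linarith
  \<comment> \<open>The power in H is chosen so that the leading drift cancels for large s. Although
    multiplied by s, what remains is bounded: e is at most sqrt d / 2, and s \<xi> is nonpositive,
    so it helps in Re B.\<close>
  have drift: "of_real s * (\<sigma> + Complex \<mu> 1)
      = Complex (\<mu> + 1) 1 * of_real e + of_real (s * \<xi>)"
    by (simp add: complex_eq_iff \<sigma>_def e_def algebra_simps)
  have B: "B = of_real (2 * (1 - \<delta> / 4) * (\<theta> - \<Theta>)) * q + q * \<sigma> + of_real (n - 2) * q
      - (Complex (\<mu> + 1) 1 * of_real e + of_real (s * \<xi>)) / 2"
    unfolding drift[symmetric] B_def by simp
  have "Re B = x * ((2 - \<delta> / 2) * (\<theta> - \<Theta>) + n - 1 - (2 * \<mu> + 1 + \<delta> / 4) * \<theta>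
      - \<delta> / 16 * (\<Theta> * \<nu> / N)) - ((1 + \<mu>) * e - \<delta> / 16 * (\<Theta> * \<rho> / N)) / 2"
    unfolding B s\<xi> unfolding q_def \<sigma>_def \<xi>_def
    by (simp add: diff_divide_distrib add_divide_distrib) (simp add: algebra_simps)
  then have "x * \<delta> / 16 \<le> Re B"
    using tangential_estimate[OF par(1-5) \<theta> \<Theta> less_imp_le[OF \<nu>(1)] \<nu>(2) \<rho> N x(1) x1 e2] by simp
  moreover have "x0 * \<delta> / 16 \<le> x * \<delta> / 16"
    using x par by (intro divide_right_mono mult_right_mono) auto
  ultimately show "x0 * \<delta> / 16 \<le> Re B" by linarith
  have "cmod B \<le> cmod (of_real (2 * (1 - \<delta> / 4) * (\<theta> - \<Theta>)) * q) + cmod (q * \<sigma>) + cmod (of_real (n - 2) * q)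
      + cmod ((Complex (\<mu> + 1) 1 * of_real e + of_real (s * \<xi>)) / 2)"
    unfolding B by (intro order_trans[OF norm_triangle_ineq4] add_mono order_refl
        order_trans[OF norm_triangle_ineq])
  also have "\<dots> \<le> 2 * (\<mu> + 2) + (\<mu> + 2) * (\<mu> + 4) + (n - 2) * (\<mu> + 2) + (\<mu> + 3)"
  proof (intro add_mono)
    have "\<bar>2 * (1 - \<delta> / 4) * (\<theta> - \<Theta>)\<bar> = 2 * ((1 - \<delta> / 4) * \<bar>\<theta> - \<Theta>\<bar>)"
      using par by (simp add: abs_mult)
    also have "\<dots> \<le> 2 * (1 * 1)"
      using \<theta> \<Theta> par by (intro mult_left_mono mult_mono) auto
    finally have "\<bar>2 * (1 - \<delta> / 4) * (\<theta> - \<Theta>)\<bar> \<le> 2" by simp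
    then show "cmod (of_real (2 * (1 - \<delta> / 4) * (\<theta> - \<Theta>)) * q) \<le> 2 * (\<mu> + 2)"
      unfolding norm_mult norm_of_real using rad(3) by (intro mult_mono) auto
    show "cmod (q * \<sigma>) \<le> (\<mu> + 2) * (\<mu> + 4)"
      unfolding norm_mult using rad(2,3) par by (intro mult_mono) auto
    show "cmod (of_real (n - 2) * q) \<le> (n - 2) * (\<mu> + 2)"
      unfolding norm_mult norm_of_real using rad(3) par by (intro mult_mono) auto
    have "cmod (Complex (\<mu> + 1) 1) \<le> \<mu> + 2"
      using cmod_le[of "Complex (\<mu> + 1) 1"] par by simp
    then have "cmod (Complex (\<mu> + 1) 1 * of_real e) \<le> (\<mu> + 2) * 1"
      unfolding norm_mult norm_of_real using e e1 par by (intro mult_mono) auto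
    moreover have "\<bar>s * \<xi>\<bar> \<le> 1"
      unfolding s\<xi> using \<delta>_mult[OF f2] par by linarith
    ultimately have "cmod (Complex (\<mu> + 1) 1 * of_real e + of_real (s * \<xi>)) \<le> \<mu> + 2 + 1"
      by (intro norm_triangle_le add_mono) (auto simp del: of_real_mult)
    then show "cmod ((Complex (\<mu> + 1) 1 * of_real e + of_real (s * \<xi>)) / 2) \<le> \<mu> + 3"
      using par by (simp add: norm_divide del: of_real_mult)
  qed
  also have "\<dots> = (\<mu> + 2) * (2 + (\<mu> + 4) + (n - 2)) + (\<mu> + 3)"
    by (simp add: algebra_simps)
  finally show "cmod B \<le> (\<mu> + 2) * (2 + (\<mu> + 4) + (n - 2)) + (\<mu> + 3)" .
qed

text \<open>Only H is exposed by its formula: the asymptotics and the absence of zeros are read off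
  from it, while the other profiles matter through the locale assumptions alone.\<close>

lemma radial_profile_exists:
  fixes \<mu> :: real
  assumes "CARD('n::finite) \<ge> 2" and "0 \<le> \<mu>" and "2 * \<mu> < real CARD('n)"
  obtains d c :: real and H H' \<alpha> \<alpha>' \<beta> \<beta>' a b lam M
  where "0 < d" and "0 < c"
    and "H = (\<lambda>s. exp (- Complex (\<mu> + 1) 1 / 4 * of_real (ln (d + s\<^sup>2)))
          * (1 + of_real c * exp (- (1/2) * of_real (ln (1 + s\<^sup>2)))))"
    and "radial_profile TYPE('n) \<mu> H H' \<alpha> \<alpha>' \<beta> \<beta>' a b lam M"
proof -
  define n where "n = real CARD('n)"
  define \<delta> where "\<delta> = min 1 (n - 2 * \<mu>)"
  have par: "0 \<le> \<mu>" "0 < \<delta>" "\<delta> \<le> 1" "\<delta> \<le> n - 2 * \<mu>" "n \<ge> 2"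
    using assms by (auto simp: n_def \<delta>_def)
  obtain d where d: "0 < d" "d \<le> 1"
    and small: "(1 + \<mu>) * sqrt d / 4 \<le> \<delta>\<^sup>2 / 4096 * d powr ((1 - \<delta> / 4) / 2) * \<delta> / 16"
    using small_parameter_exists[OF par(1,2)] by blast
  \<comment> \<open>At infinity H behaves like s^(2 z) = |x|^(-\<mu> - 1 - i); the linear factor of
    the solution restores one power of |x|.\<close>
  define z where "z = - Complex (\<mu> + 1) 1 / 4"
  define P where "P = (\<lambda>(\<kappa>::real) (z::complex) s. exp (z * of_real (ln (\<kappa> + s\<^sup>2))))"
  have elP: "elementary (P \<kappa> z)" if "\<kappa> > 0" for \<kappa> z
    using elementary.power[OF that, of 1 z] by (simp add: P_def)
  have P: "(P \<kappa> z has_vector_derivative of_real (2 * s / (\<kappa> + s\<^sup>2)) * z * P \<kappa> z s) (at s)"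
    if "\<kappa> > 0" for \<kappa> z s
    using has_vector_derivative_exp_ln[OF that, of 1 z s] by (simp add: P_def)
  define c where "c = \<delta> / 32"
  define p where "p = (1 - \<delta> / 4) / 2"
  define K where "K = of_real (\<delta>\<^sup>2 / 4096) * Complex 1 (- (\<mu> + \<delta> / 4))"
  define N where "N = (\<lambda>s. 1 + of_real c * P 1 (- (1/2)) s)"
  define H where "H = (\<lambda>s. P d z s * N s)"
  define q where "q = (\<lambda>s. K * (P d (of_real p) s * P 1 (- of_real p) s))"
  define \<gamma> where "\<gamma> = (\<lambda>s. q s * H s)"
  have elH: "elementary H" and el\<gamma>: "elementary \<gamma>"
    unfolding \<gamma>_def q_def H_def N_def using d by (auto intro!: elementary_intros elP)
  obtain H' where H': "elementary H'" "\<And>s. (H has_vector_derivative H' s) (at s)"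
    using elementary_derivative[OF elH] by blast
  obtain \<gamma>' where \<gamma>': "elementary \<gamma>'" "\<And>s. (\<gamma> has_vector_derivative \<gamma>' s) (at s)"
    using elementary_derivative[OF el\<gamma>] by blast
  \<comment> \<open>With \<alpha> = \<gamma> - s \<beta>, the terms with \<beta>' cancel in
    \<open>balance\<close> and its left side becomes 2 \<gamma>' + (n - 1) \<beta>. So \<beta> comes
    from a division by n - 1, with no differential equation to solve.\<close>
  define \<beta> where "\<beta> = (\<lambda>s. of_real (1 / (n - 1)) * ((1/2) * ((\<i> + of_real \<mu> + 1) * H s
      + (2 * of_real s) * H' s) - 2 * \<gamma>' s))"
  have el\<beta>: "elementary \<beta>"
    unfolding \<beta>_def using elH H'(1) \<gamma>'(1) by (intro elementary_intros)
  obtain \<beta>' where \<beta>': "elementary \<beta>'" "\<And>s. (\<beta> has_vector_derivative \<beta>' s) (at s)"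
    using elementary_derivative[OF el\<beta>] by blast
  define \<alpha> where "\<alpha> = (\<lambda>s. \<gamma> s - of_real s * \<beta> s)"
  define \<alpha>' where "\<alpha>' = (\<lambda>s. \<gamma>' s - (of_real s * \<beta>' s + \<beta> s))"
  have el\<alpha>: "elementary \<alpha>" "elementary \<alpha>'"
    unfolding \<alpha>_def \<alpha>'_def using el\<gamma> el\<beta> \<beta>'(1) \<gamma>'(1) by (auto intro!: elementary_intros)
  have ident: "(of_real has_vector_derivative (1::complex)) (at s)" for s
    using has_vector_derivative_of_real[OF DERIV_ident] by simp
  have \<alpha>': "(\<alpha> has_vector_derivative \<alpha>' s) (at s)" for s
    unfolding \<alpha>_def \<alpha>'_def
    using has_vector_derivative_diff[OF \<gamma>'(2) has_vector_derivative_mult[OF ident \<beta>'(2)]] by simp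
  define a where "a = (\<lambda>s. \<gamma> s / (H s + of_real (2 * s) * H' s))"
  define b where "b = (\<lambda>s. \<alpha> s / H s)"
  \<comment> \<open>\<open>lam0\<close> bounds Re q from below for all s \<ge> 0. The divisions by n
    - 1 below reflect b = B / (n - 1).\<close>
  define lam0 where "lam0 = \<delta>\<^sup>2 / 4096 * d powr p"
  define lam where "lam = min (lam0 * (\<delta> / 8) / (\<mu> + 4)\<^sup>2) (lam0 * \<delta> / 16 / (n - 1))"
  define M where "M = max (8 * (\<mu> + 2)\<^sup>2 / \<delta>)
      (((\<mu> + 2) * (2 + (\<mu> + 4) + (n - 2)) + (\<mu> + 3)) / (n - 1))"
  have nz: "H s \<noteq> 0 \<and> H s + of_real (2 * s) * H' s \<noteq> 0 \<and> lam \<le> Re (a s) \<and> lam \<le> Re (b s)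
      \<and> cmod (a s) \<le> M \<and> cmod (b s) \<le> M" if s: "s \<ge> 0" for s
  proof -
    define \<theta> where "\<theta> = s\<^sup>2 / (d + s\<^sup>2)"
    define \<Theta> where "\<Theta> = s\<^sup>2 / (1 + s\<^sup>2)"
    define \<nu> where "\<nu> = exp (- (1/2) * ln (1 + s\<^sup>2))"
    define x where "x = \<delta>\<^sup>2 / 4096 * (exp (p * ln (d + s\<^sup>2)) * exp (- p * ln (1 + s\<^sup>2)))"
    define Nr where "Nr = 1 + \<delta> / 32 * \<nu>"
    define \<xi> where "\<xi> = - (\<delta> / 16 * (\<Theta> * \<nu> / Nr))"
    define \<sigma> where "\<sigma> = 1 - Complex (\<mu> + 1) 1 * of_real \<theta> + of_real \<xi>"
    define Q where "Q = of_real x * Complex 1 (- (\<mu> + \<delta> / 4))"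
    define B where "B = of_real (2 * (1 - \<delta> / 4) * (\<theta> - \<Theta>)) * Q + Q * \<sigma> + of_real (n - 2) * Q
      - of_real (s / 2) * (\<sigma> + Complex \<mu> 1)"
    note bounds = coefficient_bounds[OF par d small s,
        folded \<theta>_def \<Theta>_def \<nu>_def p_def, folded lam0_def x_def Nr_def, folded \<xi>_def Q_def,
        folded \<sigma>_def, folded B_def]
    have pos: "0 < d + s\<^sup>2" "0 < 1 + s\<^sup>2"
      using d by (auto simp: add_pos_nonneg)
    have \<nu>: "P 1 (- (1/2)) s = of_real \<nu>"
      by (simp add: P_def \<nu>_def exp_of_real[symmetric])
    have Nr: "Nr > 0"
      using par by (simp add: Nr_def \<nu>_def add_pos_nonneg)
    have N: "N s = of_real Nr"
      by (simp add: N_def Nr_def \<nu> c_def)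
    have H0: "H s \<noteq> 0"
      using Nr by (simp add: H_def N P_def)
    have q: "q s = Q"
      by (simp add: q_def Q_def K_def P_def x_def exp_of_real[symmetric])
    have "(N has_vector_derivative of_real c * (of_real (2 * s / (1 + s\<^sup>2)) * (- (1/2)) * P 1 (- (1/2)) s)) (at s)"
      unfolding N_def
      using has_vector_derivative_add[OF has_vector_derivative_const has_vector_derivative_mult_right[OF P[OF zero_less_one]]]
      by (simp only: add_0_left)
    from has_vector_derivative_mult[OF P[OF d(1)] this]
    have "(H has_vector_derivative P d z s * (of_real c * (of_real (2 * s / (1 + s\<^sup>2)) * (- (1/2)) * P 1 (- (1/2)) s))
        + of_real (2 * s / (d + s\<^sup>2)) * z * P d z s * N s) (at s)"
      unfolding H_def .
    then have H's: "H' s = P d z s * (of_real c * (of_real (2 * s / (1 + s\<^sup>2)) * (- (1/2)) * P 1 (- (1/2)) s))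
        + of_real (2 * s / (d + s\<^sup>2)) * z * P d z s * N s"
      using H'(2) vector_derivative_unique_at by blast
    \<comment> \<open>This is the logarithmic derivative of H: the power contributes 4 \<theta> z =
      -(\<mu> + 1 + i) \<theta>, and the correction factor contributes \<xi>, whose constant
      \<delta>/16 is 2 c.\<close>
    have sH': "of_real (2 * s) * H' s = (\<sigma> - 1) * H s"
    proof -
      have "P d z s * (of_real c * (of_real (2 * s / (1 + s\<^sup>2)) * (- (1/2)) * P 1 (- (1/2)) s))
          = H s * of_real (- (c * s * \<nu> / ((1 + s\<^sup>2) * Nr)))"
      proof -
        define t where "t = s / (1 + s\<^sup>2)"
        have t: "2 * s / (1 + s\<^sup>2) = 2 * t" "c * s * \<nu> / ((1 + s\<^sup>2) * Nr) = c * t * \<nu> / Nr"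
          by (simp_all add: t_def)
        show ?thesis
          unfolding t using Nr by (simp add: H_def N \<nu>)
      qed
      then have "of_real (2 * s) * H' s
          = H s * (of_real (2 * s * - (c * s * \<nu> / ((1 + s\<^sup>2) * Nr))) + of_real (2 * s * (2 * s / (d + s\<^sup>2))) * z)"
        unfolding H's by (simp add: H_def algebra_simps)
      moreover have "2 * s * - (c * s * \<nu> / (D * Nr)) = - (\<delta> / 16 * (s\<^sup>2 / D * \<nu> / Nr))" for D
        by (simp add: c_def power2_eq_square mult_ac)
      then have "2 * s * - (c * s * \<nu> / ((1 + s\<^sup>2) * Nr)) = \<xi>"
        by (simp only: \<xi>_def \<Theta>_def)
      moreover have "2 * s * (2 * s / (d + s\<^sup>2)) = 4 * \<theta>"
        by (simp add: \<theta>_def power2_eq_square)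
      then have "of_real (2 * s * (2 * s / (d + s\<^sup>2))) * z = - (Complex (\<mu> + 1) 1 * of_real \<theta>)"
        by (simp only:) (simp add: z_def)
      ultimately have "of_real (2 * s) * H' s = H s * (of_real \<xi> + - (Complex (\<mu> + 1) 1 * of_real \<theta>))"
        by (simp only:)
      then show ?thesis
        by (simp add: \<sigma>_def algebra_simps)
    qed
    have "(q has_vector_derivative K * (P d (of_real p) s * (of_real (2 * s / (1 + s\<^sup>2)) * (- of_real p) * P 1 (- of_real p) s)
        + of_real (2 * s / (d + s\<^sup>2)) * of_real p * P d (of_real p) s * P 1 (- of_real p) s)) (at s)"
      unfolding q_def
      by (intro has_vector_derivative_mult_right has_vector_derivative_mult P) (use d in auto)
    then have "(q has_vector_derivative of_real (2 * s / (d + s\<^sup>2) - 2 * s / (1 + s\<^sup>2)) * of_real p * q s) (at s)"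
      by (simp add: q_def algebra_simps)
    from has_vector_derivative_mult[OF this H'(2)]
    have "\<gamma>' s = q s * H' s + of_real (2 * s / (d + s\<^sup>2) - 2 * s / (1 + s\<^sup>2)) * of_real p * q s * H s"
      using \<gamma>'(2) vector_derivative_unique_at unfolding \<gamma>_def by blast
    then have "of_real (2 * s) * \<gamma>' s
        = q s * (of_real (2 * s) * H' s) + of_real (2 * s * (2 * s / (d + s\<^sup>2) - 2 * s / (1 + s\<^sup>2))) * of_real p * q s * H s"
      by (simp only: of_real_mult distrib_left mult_ac)
    moreover have "2 * s * (2 * s / (d + s\<^sup>2) - 2 * s / (1 + s\<^sup>2)) = 4 * (\<theta> - \<Theta>)"
      by (simp add: \<theta>_def \<Theta>_def power2_eq_square algebra_simps)
    ultimately have s\<gamma>': "of_real (2 * s) * \<gamma>' s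
        = (Q * (\<sigma> - 1) + of_real (4 * (\<theta> - \<Theta>)) * of_real p * Q) * H s"
      by (simp only: q sH') (simp add: algebra_simps)
    have n1: "n - 1 > 0" using par by simp
    \<comment> \<open>Multiplication by n - 1 clears the denominator of \<beta>. Derivatives then
      occur only as 2 s H' and 2 s \<gamma>', both already known as multiples of H.\<close>
    have "of_real (n - 1) * \<alpha> s = of_real (n - 1) * (Q * H s)
        - (of_real (s / 2) * ((\<i> + of_real \<mu> + 1) * H s + of_real (2 * s) * H' s) - of_real (2 * s) * \<gamma>' s)"
      using n1 by (simp add: \<alpha>_def \<beta>_def \<gamma>_def q field_simps)
    also have "\<dots> = B * H s"
      unfolding s\<gamma>' sH' B_def p_def by (simp add: Complex_eq field_simps)
    finally have nb: "of_real (n - 1) * \<alpha> s = B * H s" .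
    have b: "b s = B / of_real (n - 1)"
    proof -
      have "\<alpha> s = B / of_real (n - 1) * H s"
        using nb n1 by (simp add: field_simps del: of_real_diff)
      then show ?thesis using H0 by (simp add: b_def)
    qed
    have Hs: "H s + of_real (2 * s) * H' s = \<sigma> * H s"
      unfolding sH' by (simp add: algebra_simps)
    have a: "a s = Q / \<sigma>"
      unfolding a_def Hs \<gamma>_def q using H0 by simp
    have "lam0 * \<delta> / 16 / (n - 1) \<le> Re B / (n - 1)"
      using bounds(4) n1 by (intro divide_right_mono) auto
    then have "lam \<le> Re (b s)"
      unfolding b lam_def by (simp add: Re_divide_of_real del: of_real_diff)
    moreover have "cmod B / (n - 1) \<le> ((\<mu> + 2) * (2 + (\<mu> + 4) + (n - 2)) + (\<mu> + 3)) / (n - 1)"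
      using bounds(5) n1 by (intro divide_right_mono) auto
    then have "cmod (b s) \<le> M"
      unfolding b M_def using n1 by (simp add: norm_divide del: of_real_diff)
    moreover have "lam \<le> Re (a s)" "cmod (a s) \<le> M"
      unfolding a using bounds(2,3) by (auto simp: lam_def M_def)
    ultimately show ?thesis
      using H0 Hs bounds(1) by simp
  qed
  have lam: "lam > 0"
    using par d by (simp add: lam_def lam0_def)
  have "radial_profile TYPE('n) \<mu> H H' \<alpha> \<alpha>' \<beta> \<beta>' a b lam M"
  proof unfold_locales
    show "2 * \<alpha>' s + of_real (2 * s) * \<beta>' s + of_nat (CARD('n) + 1) * \<beta> s
      = (1/2) * ((\<i> + of_real \<mu> + 1) * H s + of_real (2 * s) * H' s)" for s
    proof -
      have "of_real (n - 1) * \<beta> s = (1/2) * ((\<i> + of_real \<mu> + 1) * H s + of_real (2 * s) * H' s) - 2 * \<gamma>' s"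
        using par by (simp add: \<beta>_def del: of_real_diff)
      moreover have "2 * \<alpha>' s + of_real (2 * s) * \<beta>' s + of_nat (CARD('n) + 1) * \<beta> s
          = 2 * \<gamma>' s + of_real (n - 1) * \<beta> s"
        by (simp add: \<alpha>'_def n_def algebra_simps)
      ultimately show ?thesis
        by simp
    qed
    show "a \<in> borel_measurable borel" "b \<in> borel_measurable borel"
      unfolding a_def b_def
      by (intro borel_measurable_divide borel_measurable_continuous_onI elementary_continuous elH el\<alpha> el\<gamma>
          continuous_intros H'(1))+
    show "a s * (H s + of_real (2 * s) * H' s) = \<alpha> s + of_real s * \<beta> s" if "s \<ge> 0" for s
      using nz[OF that] by (simp add: a_def \<alpha>_def)
    show "b s * H s = \<alpha> s" if "s \<ge> 0" for s
      using nz[OF that] by (simp add: b_def)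
  qed (use lam nz H' \<alpha>' \<beta>' el\<alpha> elementary_continuous in auto)
  moreover have "H = (\<lambda>s. exp (- Complex (\<mu> + 1) 1 / 4 * of_real (ln (d + s\<^sup>2)))
          * (1 + of_real c * exp (- (1/2) * of_real (ln (1 + s\<^sup>2)))))"
    by (simp add: H_def N_def P_def z_def)
  moreover have "0 < c" using par by (simp add: c_def)
  ultimately show thesis
    using that d by blast
qed

section \<open>Conclusion and asymptotic form\<close>

theorem theorem2p1:
  fixes \<mu> :: real
  assumes "CARD('n::finite) \<ge> 2" and "0 \<le> 2 * \<mu>" and "2 * \<mu> < real CARD('n)"
  shows "\<exists>(A :: real^'n \<Rightarrow> complex^'n^'n) (w :: real^'n \<Rightarrow> complex) (G :: real^'n \<Rightarrow> complex^'n)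
            (g :: real^'n \<Rightarrow> complex) (E :: real \<Rightarrow> complex) lam Lam.
     bounded_measurable_matrix A \<and> lam > 0 \<and> Lam > 0 \<and> uniformly_elliptic A lam Lam \<and>
     H1_loc w G \<and> \<not> (AE x in lebesgue. w x = 0) \<and> weak_solution A \<mu> w G \<and>
     smooth_on_sphere g \<and> smooth_on UNIV E \<and> E 0 = 0 \<and>
     (\<forall>x. norm x \<ge> 1 \<longrightarrow>
        w x = of_real (norm x powr (- \<mu>)) * g (x /\<^sub>R norm x)
              * exp (- \<i> * of_real (ln (norm x))) * (1 + E (inverse ((norm x)\<^sup>2))))"
proof -
  obtain k0 :: 'n where True by simp
  have \<mu>: "0 \<le> \<mu>" using assms by simp
  obtain d c :: real and H H' \<alpha> \<alpha>' \<beta> \<beta>' a b lam M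
    where d: "0 < d" and c: "0 < c"
      and H_eq: "H = (\<lambda>s. exp (- Complex (\<mu> + 1) 1 / 4 * of_real (ln (d + s\<^sup>2)))
          * (1 + of_real c * exp (- (1/2) * of_real (ln (1 + s\<^sup>2)))))"
      and rp: "radial_profile TYPE('n) \<mu> H H' \<alpha> \<alpha>' \<beta> \<beta>' a b lam M"
    by (rule radial_profile_exists[OF assms(1) \<mu> assms(3)])
  \<comment> \<open>Any coordinate can serve as \<open>k0\<close>, because the profile conditions
    see only the dimension.\<close>
  interpret radial_profile k0 \<mu> H H' \<alpha> \<alpha>' \<beta> \<beta>' a b lam M
    by (rule rp)
  define z where "z = - Complex (\<mu> + 1) 1 / 4"
  define g where "g = (\<lambda>x::real^'n. complex_of_real (x $ k0))"
  \<comment> \<open>Put y = 1/s. Factoring s^2 out of d + s^2 and 1 + s^2 turns the profile into a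
    function of y that is smooth on the whole line, with y = 0 standing for infinity. The factor
    \<open>1 *\<close> fits the rule \<open>power\<close>.\<close>
  define E where "E = (\<lambda>y. exp (z * of_real (ln (1 + d * y\<^sup>2)))
      * (1 + of_real c * (of_real y * exp (- (1/2) * of_real (ln (1 + 1 * y\<^sup>2))))) - 1)"
  have H0: "H s \<noteq> 0" for s
  proof -
    have "1 + of_real c * exp (- (1/2) * of_real (ln (1 + s\<^sup>2)))
        = complex_of_real (1 + c * exp (- (1/2) * ln (1 + s\<^sup>2)))"
      by (simp add: exp_of_real[symmetric])
    moreover have "1 + c * exp (- (1/2) * ln (1 + s\<^sup>2)) > 0"
      using c by (simp add: add_pos_pos)
    ultimately have "1 + of_real c * exp (- (1/2) * of_real (ln (1 + s\<^sup>2))) \<noteq> (0::complex)"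
      by (simp only: of_real_eq_0_iff less_imp_neq[THEN not_sym] not_False_eq_True)
    then show ?thesis
      by (simp only: H_eq mult_eq_0_iff exp_not_eq_zero simp_thms)
  qed
  have g: "smooth_on_sphere g"
    unfolding smooth_on_sphere_def
    by (intro exI[of _ UNIV] exI[of _ g] conjI smooth_on_bounded_linear)
      (auto simp: g_def intro!: bounded_linear_compose[OF bounded_linear_of_real] bounded_linear_vec_nth)
  have E: "smooth_on UNIV E"
    unfolding E_def using d by (intro elementary_smooth elementary_intros) auto
  have E0: "E 0 = 0" by (simp add: E_def)
  have asymp: "sol x = of_real (norm x powr (- \<mu>)) * g (x /\<^sub>R norm x)
      * exp (- \<i> * of_real (ln (norm x))) * (1 + E (inverse ((norm x)\<^sup>2)))" if "norm x \<ge> 1" for x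
  proof -
    define r where "r = norm x"
    define y where "y = inverse (r\<^sup>2)"
    define l where "l = complex_of_real (ln r)"
    have r: "r > 0" using that unfolding r_def by linarith
    have ln_eq: "ln (\<kappa> + (r\<^sup>2)\<^sup>2) = 4 * ln r + ln (1 + \<kappa> * y\<^sup>2)" if "\<kappa> > 0" for \<kappa>
    proof -
      have "\<kappa> + (r\<^sup>2)\<^sup>2 = r ^ 4 * (1 + \<kappa> * y\<^sup>2)"
        using r by (simp add: y_def field_simps)
      moreover have "1 + \<kappa> * y\<^sup>2 > 0" using that by (simp add: add_pos_nonneg)
      ultimately show ?thesis using r by (simp add: ln_mult ln_realpow)
    qed
    have e1: "exp (z * of_real (ln (d + (r\<^sup>2)\<^sup>2)))
        = exp (- Complex (\<mu> + 1) 1 * l) * exp (z * of_real (ln (1 + d * y\<^sup>2)))"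
      unfolding ln_eq[OF d] exp_add[symmetric] by (simp add: z_def l_def algebra_simps)
    have "exp (- (1/2) * complex_of_real (ln (1 + (r\<^sup>2)\<^sup>2)))
        = exp (- 2 * l) * exp (- (1/2) * of_real (ln (1 + 1 * y\<^sup>2)))"
      unfolding ln_eq[OF zero_less_one] exp_add[symmetric] by (simp add: l_def algebra_simps)
    moreover have "exp (- 2 * l) = of_real y"
    proof -
      have "exp (- 2 * l) = of_real (exp (- (2 * ln r)))"
        by (simp add: l_def exp_of_real[symmetric])
      also have "exp (- (2 * ln r)) = y"
        using r by (simp add: y_def exp_minus exp_double)
      finally show ?thesis .
    qed
    ultimately have e2: "exp (- (1/2) * complex_of_real (ln (1 + (r\<^sup>2)\<^sup>2)))
        = of_real y * exp (- (1/2) * of_real (ln (1 + 1 * y\<^sup>2)))" by simp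
    have "H (r\<^sup>2) = exp (- Complex (\<mu> + 1) 1 * l) * (1 + E y)"
      unfolding H_eq z_def[symmetric] e1 e2 by (simp add: E_def)
    \<comment> \<open>The power r^(-\<mu> - 1 - i) is split so that the factor 1/r normalises the
      linear function to g(x/|x|), leaving the required modulus and phase.\<close>
    moreover have "exp (- Complex (\<mu> + 1) 1 * l)
        = of_real (r powr (- \<mu>)) * of_real (1 / r) * exp (- \<i> * l)"
    proof -
      have "exp (- Complex (\<mu> + 1) 1 * l) = exp (of_real (- \<mu> * ln r)) * exp (of_real (- ln r)) * exp (- \<i> * l)"
        unfolding exp_add[symmetric]
        by (rule arg_cong[where f = exp]) (simp add: Complex_eq l_def algebra_simps)
      also have "exp (complex_of_real (- \<mu> * ln r)) = of_real (r powr (- \<mu>))"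
        using r by (simp only: exp_of_real powr_def) simp
      also have "exp (complex_of_real (- ln r)) = of_real (1 / r)"
        using r by (simp only: exp_of_real) (simp add: exp_minus inverse_eq_divide)
      finally show ?thesis .
    qed
    ultimately show ?thesis
      unfolding sol_def g_def r_def[symmetric] y_def[symmetric] l_def[symmetric]
      by (simp add: divide_inverse mult_ac)
  qed
  have "3 * M > 0" using M_pos by simp
  then show ?thesis
    by (intro exI[of _ coeff] exI[of _ sol] exI[of _ grad_sol] exI[of _ g] exI[of _ E]
        exI[of _ lam] exI[of _ "3 * M"] conjI allI impI asymp bounded_measurable_coeff lower(1)
        uniformly_elliptic_coeff H1_loc_sol sol_nontrivial[OF H0] weak_solution_sol g E E0)
qed

end
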